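(* Let $(P_n)_{n\in\mathbb{N}}$ be a sequence of nonconstant polynomials with complex coefficients, written as $P_n(z)=\sum_{j=m(n)}^{d(n)}c_{j,n}z^j$ with $m(n)\le d(n)$ and $c_{m(n),n}\neq 0\neq c_{d(n),n}$. Assume that: (a) the sequence $(m(n))_{n\in\mathbb{N}}$ of valences is unbounded; (b) at least one of the following three properties is satisfied: (P) there is an $\mathcal{E}$-unicity set $U\subset\mathbb{C}$ such that $\lim_{n\to\infty}|P_n(z)|=+\infty$ for all $z\in U$; (Q) for each $k\in\mathbb{N}$, $\lim_{n\to\infty}m(n)\,|c_{m(n),n}|^{k/m(n)}=+\infty$ and the sequence $\{c_{k+m(n),n}:n\in\mathbb{N}\}$ is bounded, where $c_{j,n}=0$ if $j>d(n)$ (here $m(n)\geq 1$ for all sufficiently large $n$, so that the expression in the limit is defined); (R) there is $r>0$ such that $\lim_{n\to\infty}\min\{|P_n(z)|:|z|=r\}=+\infty$. Then the set $HC((P_n(D)))$ is maximal dense-lineable in $H(\mathbb{C})$.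
   Context: $\mathbb{N}=\{1,2,3,\dots\}$. $H(\mathbb{C})$ is the Fréchet space of all entire functions with the topology of uniform convergence on compact sets. For a polynomial $P(z)=\sum_{j}c_jz^j$, $P(D)$ is the continuous linear operator on $H(\mathbb{C})$ given by $P(D)f=\sum_j c_j f^{(j)}$. The valence of a nonconstant polynomial $P(z)=\sum_{j=m}^d c_jz^j$ with $c_m\ne0\ne c_d$ is $m\in\mathbb{N}\cup\{0\}$ (the multiplicity at the origin). For a sequence $T_n:X\to Y$ of continuous linear mappings between topological vector spaces, $x_0\in X$ is hypercyclic for $(T_n)$ if $\{T_n(x_0):n\in\mathbb{N}\}$ is dense in $Y$; $HC((T_n))$ is the set of all vectors hypercyclic for $(T_n)$. $\mathcal{E}$ is the class of entire functions of exponential type, i.e. entire $\Phi$ for which there are positive constants $A,B$ with $|\Phi(z)|\le Ae^{B|z|}$ for all $z\in\mathbb{C}$. A set $U\subset\mathbb{C}$ is an $\mathcal{E}$-unicity set if every $f\in\mathcal{E}$ with $f(z)=0$ for all $z\in U$ satisfies $f\equiv0$. A subset $A$ of a topological vector space $X$ is maximal dense-lineable if there is a dense vector subspace $M\subset X$ with $\dim(M)=\dim(X)$ (algebraic dimension) and $M\subset A\cup\{0\}$. *)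

theory Defs
  imports
    "HOL-Complex_Analysis.Complex_Analysis"
    "HOL-Computational_Algebra.Polynomial"
    "HOL-Library.Function_Algebras"
    "HOL-Library.Equipollence"
begin

section \<open>The space of entire functions\<close>

definition entire :: "(complex \<Rightarrow> complex) set" where
  "entire = {f. f holomorphic_on UNIV}"

text \<open>The basic neighbourhoods of \<open>f\<close> in the compact-open topology are the sets
  \<open>{g entire. |g - f| < e on K}\<close> with \<open>K\<close> compact and \<open>e > 0\<close>.\<close>

definition entire_topology :: "(complex \<Rightarrow> complex) topology" where
  "entire_topology = topology (\<lambda>S. S \<subseteq> entire \<and>
     (\<forall>f\<in>S. \<exists>K e. compact K \<and> e > 0 \<and> {g \<in> entire. \<forall>z\<in>K. norm (g z - f z) < e} \<subseteq> S))"

lemma openin_entire_topology: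
  "openin entire_topology S \<longleftrightarrow> S \<subseteq> entire \<and>
     (\<forall>f\<in>S. \<exists>K e. compact K \<and> e > 0 \<and> {g \<in> entire. \<forall>z\<in>K. norm (g z - f z) < e} \<subseteq> S)"
proof -
  define N where "N f K e = {g \<in> entire. \<forall>z\<in>K. norm (g z - f z) < e}"
    for f :: "complex \<Rightarrow> complex" and K and e :: real
  define Q where "Q S f \<longleftrightarrow> (\<exists>K e. compact K \<and> e > 0 \<and> N f K e \<subseteq> S)" for S f
  have mono: "Q T f" if "Q S f" "S \<subseteq> T" for S T f
    using that unfolding Q_def by (meson order_trans)
  have inter: "Q (S \<inter> T) f" if S: "Q S f" and T: "Q T f" for S T f
  proof -
    obtain K e where 1: "compact K" "e > 0" "N f K e \<subseteq> S"
      using S unfolding Q_def by (elim exE conjE)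
    obtain L d where 2: "compact L" "d > 0" "N f L d \<subseteq> T"
      using T unfolding Q_def by (elim exE conjE)
    have "N f (K \<union> L) (min e d) \<subseteq> N f K e" "N f (K \<union> L) (min e d) \<subseteq> N f L d"
      unfolding N_def by auto
    with 1 2 have "N f (K \<union> L) (min e d) \<subseteq> S \<inter> T" by (meson Int_greatest order_trans)
    moreover have "compact (K \<union> L)" "min e d > 0" using 1 2 by (simp_all add: compact_Un)
    ultimately show ?thesis unfolding Q_def by (intro exI conjI)
  qed
  have "istopology (\<lambda>S. S \<subseteq> entire \<and> (\<forall>f\<in>S. Q S f))"
    unfolding istopology_def
  proof (intro conjI allI impI ballI)
    fix S T f assume "S \<subseteq> entire \<and> (\<forall>f\<in>S. Q S f)" "T \<subseteq> entire \<and> (\<forall>f\<in>T. Q T f)" "f \<in> S \<inter> T"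
    then show "Q (S \<inter> T) f" by (intro inter) simp_all
  next
    fix \<K> f assume \<K>: "\<forall>S\<in>\<K>. S \<subseteq> entire \<and> (\<forall>f\<in>S. Q S f)" and f: "f \<in> \<Union>\<K>"
    from f obtain S where "S \<in> \<K>" "f \<in> S" by (rule UnionE)
    then have "Q S f" "S \<subseteq> \<Union>\<K>" using \<K> by (simp_all add: Union_upper)
    then show "Q (\<Union>\<K>) f" by (rule mono)
  qed (simp_all add: le_infI1 Union_least)
  then show ?thesis
    unfolding Q_def N_def entire_topology_def by (simp only: topology_inverse')
qed

lemma topspace_entire_topology [simp]: "topspace entire_topology = entire"
proof
  show "topspace entire_topology \<subseteq> entire"
    by (rule openin_entire_topology[THEN iffD1, THEN conjunct1, OF openin_topspace])
  have "\<exists>K e. compact K \<and> e > 0 \<and> {g \<in> entire. \<forall>z\<in>K. norm (g z - f z) < e} \<subseteq> entire"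
    for f :: "complex \<Rightarrow> complex"
    by (rule exI[of _ "{}"], rule exI[of _ 1]) simp
  then show "entire \<subseteq> topspace entire_topology"
    by (intro openin_subset) (simp add: openin_entire_topology)
qed

text \<open>The complex vector space of all functions \<open>complex \<Rightarrow> complex\<close>; addition is the pointwise
  one of \<^theory>\<open>HOL-Library.Function_Algebras\<close>.\<close>

definition cscale :: "complex \<Rightarrow> (complex \<Rightarrow> complex) \<Rightarrow> complex \<Rightarrow> complex" where
  "cscale c f = (\<lambda>z. c * f z)"

section \<open>Lineability\<close>

text \<open>The library's \<open>dim\<close> is a natural number, which does not distinguish infinite dimensions;
  equality of algebraic dimensions is therefore stated as equipollence of Hamel bases.
  The carrier of the topological vector space is \<open>topspace X\<close>.\<close>

definition same_dim :: "('a::field \<Rightarrow> 'b::ab_group_add \<Rightarrow> 'b) \<Rightarrow> 'b set \<Rightarrow> 'b set \<Rightarrow> bool" where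
  "same_dim smul V W \<longleftrightarrow>
     (\<exists>B C. \<not> module.dependent smul B \<and> module.span smul B = V \<and>
            \<not> module.dependent smul C \<and> module.span smul C = W \<and> B \<approx> C)"

definition maximal_dense_lineable ::
    "('a::field \<Rightarrow> 'b::ab_group_add \<Rightarrow> 'b) \<Rightarrow> 'b topology \<Rightarrow> 'b set \<Rightarrow> bool" where
  "maximal_dense_lineable smul X A \<longleftrightarrow>
     (\<exists>M. module.subspace smul M \<and> M \<subseteq> topspace X \<and> X closure_of M = topspace X \<and>
          same_dim smul M (topspace X) \<and> M \<subseteq> A \<union> {0})"

global_interpretation cfun: vector_space cscale
  by unfold_locales (auto simp: cscale_def fun_eq_iff algebra_simps)

lemma subspace_entire: "cfun.subspace entire"
proof (rule cfun.subspaceI)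
  show "0 \<in> entire"
    unfolding entire_def zero_fun_def mem_Collect_eq by (rule holomorphic_on_const)
  show "f + g \<in> entire" if "f \<in> entire" "g \<in> entire" for f g
    using that unfolding entire_def plus_fun_def mem_Collect_eq by (rule holomorphic_on_add)
  show "cscale c f \<in> entire" if "f \<in> entire" for c f
    using that unfolding entire_def cscale_def mem_Collect_eq
    by (intro holomorphic_on_mult holomorphic_on_const)
qed

section \<open>Hypercyclicity and differential operators\<close>

definition HC :: "'a topology \<Rightarrow> 'b topology \<Rightarrow> (nat \<Rightarrow> 'a \<Rightarrow> 'b) \<Rightarrow> 'a set" where
  "HC X Y T = {x \<in> topspace X. Y closure_of (range (\<lambda>n. T n x)) = topspace Y}"

definition diff_op :: "complex poly \<Rightarrow> (complex \<Rightarrow> complex) \<Rightarrow> complex \<Rightarrow> complex" where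
  "diff_op p f = (\<lambda>z. \<Sum>j\<le>degree p. coeff p j * (deriv ^^ j) f z)"

lemma diff_op_entire: "f \<in> entire \<Longrightarrow> diff_op p f \<in> entire"
  unfolding entire_def diff_op_def mem_Collect_eq
  by (intro holomorphic_on_sum holomorphic_on_mult holomorphic_on_const
            holomorphic_higher_deriv open_UNIV)

definition valence :: "'a::zero poly \<Rightarrow> nat" where
  "valence p = (LEAST j. coeff p j \<noteq> 0)"

section \<open>Functions of exponential type\<close>

definition exponential_type :: "(complex \<Rightarrow> complex) set" where
  "exponential_type =
     {f \<in> entire. \<exists>A>0. \<exists>B>0. \<forall>z. norm (f z) \<le> A * exp (B * norm z)}"

definition exp_unicity_set :: "complex set \<Rightarrow> bool" where
  "exp_unicity_set U \<longleftrightarrow>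
     (\<forall>f\<in>exponential_type. (\<forall>z\<in>U. f z = 0) \<longrightarrow> (\<forall>z. f z = 0))"

section \<open>The conditions on the sequence of polynomials\<close>

definition cond_P :: "(nat \<Rightarrow> complex poly) \<Rightarrow> bool" where
  "cond_P P \<longleftrightarrow> (\<exists>U. exp_unicity_set U \<and>
     (\<forall>z\<in>U. filterlim (\<lambda>n. norm (poly (P n) z)) at_top sequentially))"

text \<open>The first conjunct makes the exponent \<open>k / m(n)\<close> meaningful for all large \<open>n\<close>.\<close>

definition cond_Q :: "(nat \<Rightarrow> complex poly) \<Rightarrow> bool" where
  "cond_Q P \<longleftrightarrow> (\<forall>\<^sub>F n in sequentially. valence (P n) \<ge> 1) \<and>
     (\<forall>k\<ge>1.
        filterlim (\<lambda>n. real (valence (P n)) *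
            norm (coeff (P n) (valence (P n))) powr (real k / real (valence (P n))))
          at_top sequentially \<and>
        bounded (range (\<lambda>n. coeff (P n) (k + valence (P n)))))"

text \<open>The infimum over the compact circle is attained, i.e. it is the minimum.\<close>

definition cond_R :: "(nat \<Rightarrow> complex poly) \<Rightarrow> bool" where
  "cond_R P \<longleftrightarrow> (\<exists>r>0.
     filterlim (\<lambda>n. INF z\<in>sphere 0 r. norm (poly (P n) z)) at_top sequentially)"

end

theory Submission
  imports Defs
begin

text \<open>
  Since the valences are unbounded, along a suitable filter every \<open>P n(D)\<close> annihilates any given
  polynomial. The functions \<open>y\<close> which are limits of \<open>P n(D) (u n)\<close> for some \<open>u n \<rightarrow> 0\<close> form a
  subspace, and this subspace is dense: under (P) it contains the exponentials
  \<open>z \<mapsto> exp (a z)\<close> for \<open>a \<in> U\<close>, whose span is dense because a functional vanishing on it has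
  an exponential-type Fourier-Laplace transform vanishing on \<open>U\<close>; under (Q) it contains every
  monomial \<open>z\<^sup>j\<close>, since \<open>P n(D)\<close> acts triangularly on \<open>z\<^bsup>j+m(n)\<^esup>\<close>; and (R) implies (P), with
  a circle as unicity set.

  Hence there are tiny polynomial blocks \<open>u k\<close> and indices \<open>N k\<close> such that \<open>P (N k)(D)\<close> maps
  \<open>u k\<close> close to the \<open>k\<close>-th target, kills \<open>u j\<close> for \<open>j < k\<close> and is negligible on \<open>u j\<close> for
  \<open>j > k\<close>. Summing the blocks over the members of an almost disjoint family of continuum many
  sets of indices gives functions all of whose nontrivial linear combinations are hypercyclic,
  even after adding polynomials, which makes the span dense.
\<close>

section \<open>Entire functions and differential operators\<close>

lemma entire_closure_ofI:
  assumes "g \<in> entire" "S \<subseteq> entire"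
    and approx: "\<And>R \<epsilon>. \<epsilon> > 0 \<Longrightarrow> \<exists>f\<in>S. \<forall>z\<in>cball 0 R. norm (f z - g z) < \<epsilon>"
  shows "g \<in> entire_topology closure_of S"
  unfolding in_closure_of
proof (intro conjI allI impI)
  show "g \<in> topspace entire_topology" using assms(1) by simp
  fix T assume T: "g \<in> T \<and> openin entire_topology T"
  then obtain K e where K: "compact K" "e > 0" "{f \<in> entire. \<forall>z\<in>K. norm (f z - g z) < e} \<subseteq> T"
    unfolding openin_entire_topology by blast
  obtain R where R: "K \<subseteq> cball 0 R"
    using compact_imp_bounded[OF K(1)] by (auto simp: bounded_iff subset_iff)
  obtain f where "f \<in> S" "\<forall>z\<in>cball 0 R. norm (f z - g z) < e"
    using approx[OF K(2), of R] by blast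
  then show "\<exists>y. y \<in> S \<and> y \<in> T" using R K(3) assms(2) by blast
qed

lemma entire_holomorphic: "f \<in> entire \<Longrightarrow> f holomorphic_on S"
  unfolding entire_def using holomorphic_on_subset by blast

lemma poly_entire: "poly p \<in> entire"
  unfolding entire_def by (simp add: holomorphic_on_def field_differentiable_def) (metis poly_DERIV has_field_derivative_at_within)

lemma entire_add: "f \<in> entire \<Longrightarrow> g \<in> entire \<Longrightarrow> (\<lambda>z. f z + g z) \<in> entire"
  by (simp add: entire_def holomorphic_on_add)

lemma entire_cmult: "f \<in> entire \<Longrightarrow> (\<lambda>z. c * f z) \<in> entire"
  by (simp add: entire_def holomorphic_on_mult)

lemma entire_diff: "f \<in> entire \<Longrightarrow> g \<in> entire \<Longrightarrow> (\<lambda>z. f z - g z) \<in> entire"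
  by (simp add: entire_def holomorphic_on_diff)

lemma entire_sum: "(\<And>i. i \<in> I \<Longrightarrow> f i \<in> entire) \<Longrightarrow> (\<lambda>z. \<Sum>i\<in>I. f i z) \<in> entire"
  by (simp add: entire_def holomorphic_on_sum)

lemma entire_const: "(\<lambda>z. c) \<in> entire"
  by (simp add: entire_def)

lemma entire_exp: "(\<lambda>z. exp (a * z)) \<in> entire"
  by (auto simp: entire_def intro!: holomorphic_intros)

lemma diff_op_add:
  "f \<in> entire \<Longrightarrow> g \<in> entire \<Longrightarrow> diff_op p (\<lambda>z. f z + g z) = (\<lambda>z. diff_op p f z + diff_op p g z)"
  unfolding diff_op_def entire_def
  by (auto simp: fun_eq_iff higher_deriv_add[where S=UNIV] algebra_simps sum.distrib)

lemma diff_op_cmult: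
  "f \<in> entire \<Longrightarrow> diff_op p (\<lambda>z. c * f z) = (\<lambda>z. c * diff_op p f z)"
  unfolding diff_op_def entire_def
  by (auto simp: fun_eq_iff higher_deriv_cmult[where A=UNIV] sum_distrib_left algebra_simps)

lemma diff_op_diff:
  assumes "f \<in> entire" "g \<in> entire"
  shows "diff_op p (\<lambda>z. f z - g z) = (\<lambda>z. diff_op p f z - diff_op p g z)"
  using diff_op_add[OF assms(1) entire_cmult[OF assms(2)], of p "-1"]
    diff_op_cmult[OF assms(2), of p "-1"] by simp

lemma diff_op_zero: "diff_op p (\<lambda>z. 0) = (\<lambda>z. 0)"
  using diff_op_cmult[OF entire_const, of p 0 0] by simp

lemma diff_op_sum:
  "(\<And>i. i \<in> I \<Longrightarrow> f i \<in> entire) \<Longrightarrow> diff_op p (\<lambda>z. \<Sum>i\<in>I. f i z) = (\<lambda>z. \<Sum>i\<in>I. diff_op p (f i) z)"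
proof (induction I rule: infinite_finite_induct)
  case (insert x F)
  then show ?case
    using diff_op_add[of "f x" "\<lambda>z. \<Sum>i\<in>F. f i z" p] entire_sum[of F f] by simp
qed (auto simp: diff_op_zero)

lemma deriv_poly: "deriv (poly p) = poly (pderiv p)" for p :: "complex poly"
  by (auto simp: fun_eq_iff intro!: DERIV_imp_deriv poly_DERIV)

lemma higher_deriv_poly: "(deriv ^^ n) (poly p) = poly ((pderiv ^^ n) p)" for p :: "complex poly"
  by (induction n) (auto simp: deriv_poly)

lemma coeff_less_valence: "j < valence p \<Longrightarrow> coeff p j = 0"
  unfolding valence_def using not_less_Least by blast

lemma coeff_valence: "p \<noteq> 0 \<Longrightarrow> coeff p (valence p) \<noteq> 0"
  unfolding valence_def using LeastI[of "\<lambda>j. coeff p j \<noteq> 0" "degree p"] by auto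

lemma diff_op_poly_eq_0:
  assumes "degree q < valence p"
  shows "diff_op p (poly q) = (\<lambda>z. 0)"
proof -
  have "coeff p j * poly ((pderiv ^^ j) q) z = 0" for j z
  proof (cases "j < valence p")
    case False
    then have "(pderiv ^^ j) q = 0"
      using assms by (intro poly_eqI) (simp add: coeff_higher_pderiv coeff_eq_0)
    then show ?thesis by simp
  qed (simp add: coeff_less_valence)
  then show ?thesis
    unfolding diff_op_def higher_deriv_poly by (simp only: sum.neutral_const)
qed

lemma diff_op_bound:
  obtains C where "C > 0"
    "\<And>f R B z. f \<in> entire \<Longrightarrow> (\<And>z. norm z \<le> R + 1 \<Longrightarrow> norm (f z) \<le> B) \<Longrightarrow> norm z \<le> R
       \<Longrightarrow> norm (diff_op p f z) \<le> C * B"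
proof
  let ?C = "1 + (\<Sum>j\<le>degree p. norm (coeff p j) * fact j)"
  show "?C > 0" by (intro add_pos_nonneg sum_nonneg) auto
  fix f R B z assume f: "f \<in> entire" and B: "\<And>z. norm z \<le> R + 1 \<Longrightarrow> norm (f z) \<le> B" and z: "norm (z::complex) \<le> R"
  have B0: "B \<ge> 0" using B[of z] z norm_ge_zero[of "f z"] by linarith
  have "norm ((deriv ^^ j) f z) \<le> fact j * B / 1 ^ j" for j
  proof (rule Cauchy_inequality)
    show "continuous_on (cball z 1) f"
      using f entire_holomorphic holomorphic_on_imp_continuous_on by blast
    fix x assume "norm (z - x) = 1"
    then have "norm x \<le> norm z + 1" using norm_triangle_ineq3[of x z] norm_minus_commute[of x z] by linarith
    then show "norm (f x) \<le> B" using B z by force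
  qed (use f entire_holomorphic in auto)
  then have "norm (diff_op p f z) \<le> (\<Sum>j\<le>degree p. norm (coeff p j) * (fact j * B))"
    unfolding diff_op_def by (intro sum_norm_le) (simp add: norm_mult mult_left_mono)
  also have "\<dots> \<le> ?C * B"
    using B0 by (simp add: sum_distrib_left algebra_simps)
  finally show "norm (diff_op p f z) \<le> ?C * B" .
qed

lemma entire_Taylor_sums:
  assumes "f \<in> entire"
  shows "(\<lambda>n. (deriv ^^ n) f 0 / fact n * w ^ n) sums f w"
  using holomorphic_power_series[OF entire_holomorphic[OF assms], of w 0 "norm w + 1"] by simp

lemma entire_Taylor_uniform_limit:
  assumes "f \<in> entire"
  shows "uniform_limit (cball 0 R) (\<lambda>n z. \<Sum>i<n. (deriv ^^ i) f 0 / fact i * z ^ i) f sequentially"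
proof -
  note s = entire_Taylor_sums[OF assms]
  have "uniform_limit (cball 0 R) (\<lambda>n x. \<Sum>i<n. (deriv ^^ i) f 0 / fact i * (x - 0) ^ i)
     (\<lambda>x. \<Sum>i. (deriv ^^ i) f 0 / fact i * (x - 0) ^ i) sequentially"
  proof (rule powser_uniform_limit)
    have "summable (\<lambda>n. (deriv ^^ n) f 0 / fact n * (of_real (\<bar>R\<bar> + 1)) ^ n)"
      by (rule sums_summable[OF s])
    then have "conv_radius (\<lambda>n. (deriv ^^ n) f 0 / fact n) \<ge> norm (of_real (\<bar>R\<bar> + 1) :: complex)"
      by (rule conv_radius_geI)
    moreover have "ereal R < norm (of_real (\<bar>R\<bar> + 1) :: complex)" by simp
    ultimately show "ereal R < conv_radius (\<lambda>n. (deriv ^^ n) f 0 / fact n)" by (meson less_le_trans)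
  qed
  moreover have "(\<lambda>x. \<Sum>i. (deriv ^^ i) f 0 / fact i * (x - 0) ^ i) = f"
    using s by (simp add: sums_iff)
  ultimately show ?thesis by simp
qed

lemma entire_poly_approx:
  assumes "f \<in> entire" "\<epsilon> > 0"
  obtains p where "\<And>z. norm z \<le> R \<Longrightarrow> norm (poly p z - f z) < \<epsilon>"
proof -
  from uniform_limitD[OF entire_Taylor_uniform_limit[OF assms(1)] assms(2)] obtain n
    where n: "\<And>z. z \<in> cball 0 R \<Longrightarrow> dist (\<Sum>i<n. (deriv ^^ i) f 0 / fact i * z ^ i) (f z) < \<epsilon>"
    using eventually_happens' sequentially_bot by blast
  show ?thesis
    by (rule that[of "\<Sum>i<n. monom ((deriv ^^ i) f 0 / fact i) i"])
      (use n in \<open>simp add: poly_sum poly_monom dist_norm\<close>)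
qed

lemma complex_rat_approx:
  assumes "\<epsilon> > 0"
  obtains a b :: rat where "norm (Complex (of_rat a) (of_rat b) - c) < \<epsilon>"
proof -
  obtain a where a: "Re c < of_rat a" "of_rat a < Re c + \<epsilon>/2"
    using of_rat_dense[of "Re c" "Re c + \<epsilon>/2"] assms by auto
  obtain b where b: "Im c < of_rat b" "of_rat b < Im c + \<epsilon>/2"
    using of_rat_dense[of "Im c" "Im c + \<epsilon>/2"] assms by auto
  have "norm (Complex (of_rat a) (of_rat b) - c) \<le> \<bar>of_rat a - Re c\<bar> + \<bar>of_rat b - Im c\<bar>"
    using cmod_le[of "Complex (of_rat a) (of_rat b) - c"] by simp
  then show ?thesis by (intro that[of a b]) (use a b in linarith)
qed

definition rat_poly :: "(rat \<times> rat) list \<Rightarrow> complex poly" where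
  "rat_poly xs = Poly (map (\<lambda>(a, b). Complex (of_rat a) (of_rat b)) xs)"

lemma rat_poly_approx:
  assumes "\<epsilon> > 0"
  shows "\<exists>xs. \<forall>z. norm z \<le> R \<longrightarrow> norm (poly (rat_poly xs) z - poly p z) < \<epsilon>"
  using assms
proof (induction p arbitrary: \<epsilon>)
  case 0
  show ?case by (rule exI[of _ "[]"]) (simp add: rat_poly_def 0)
next
  case (pCons c p)
  have pos: "\<epsilon> / (2 * (\<bar>R\<bar> + 1)) > 0" using pCons.prems by simp
  obtain xs where xs: "\<And>z. norm z \<le> R \<Longrightarrow> norm (poly (rat_poly xs) z - poly p z) < \<epsilon> / (2 * (\<bar>R\<bar> + 1))"
    using pCons.IH[OF pos] by blast
  obtain a b :: rat where ab: "norm (Complex (of_rat a) (of_rat b) - c) < \<epsilon> / 2"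
    using complex_rat_approx[of "\<epsilon>/2" c] pCons.prems by auto
  show ?case
  proof (intro exI[of _ "(a, b) # xs"] allI impI)
    fix z :: complex assume z: "norm z \<le> R"
    have "norm (z * (poly (rat_poly xs) z - poly p z)) \<le> (\<bar>R\<bar> + 1) * (\<epsilon> / (2 * (\<bar>R\<bar> + 1)))"
      unfolding norm_mult using xs[OF z] z by (intro mult_mono) auto
    also have "\<dots> = \<epsilon> / 2" by (simp add: add_pos_nonneg field_simps)
    finally have 1: "norm (z * (poly (rat_poly xs) z - poly p z)) \<le> \<epsilon> / 2" .
    have "poly (rat_poly ((a, b) # xs)) z - poly (pCons c p) z
       = (Complex (of_rat a) (of_rat b) - c) + z * (poly (rat_poly xs) z - poly p z)"
      by (simp add: rat_poly_def algebra_simps)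
    moreover have "norm \<dots> < \<epsilon>"
      by (rule norm_triangle_lt) (use 1 ab in linarith)
    ultimately show "norm (poly (rat_poly ((a, b) # xs)) z - poly (pCons c p) z) < \<epsilon>"
      by (simp only:)
  qed
qed

lemma entire_rat_poly_approx:
  assumes "f \<in> entire" "\<epsilon> > 0"
  obtains l where "\<And>z. norm z \<le> R \<Longrightarrow> norm (poly (rat_poly (from_nat l)) z - f z) < \<epsilon>"
proof -
  obtain p where p: "\<And>z. norm z \<le> R \<Longrightarrow> norm (poly p z - f z) < \<epsilon>/2"
    using entire_poly_approx[OF assms(1), of "\<epsilon>/2" R] assms(2) by auto
  obtain xs where xs: "\<And>z. norm z \<le> R \<Longrightarrow> norm (poly (rat_poly xs) z - poly p z) < \<epsilon>/2"
    using rat_poly_approx[of "\<epsilon>/2" R p] assms(2) by auto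
  show ?thesis
  proof (rule that[of "to_nat xs"])
    fix z :: complex assume "norm z \<le> R"
    from p[OF this] xs[OF this] show "norm (poly (rat_poly (from_nat (to_nat xs))) z - f z) < \<epsilon>"
      using norm_triangle_lt[of "poly (rat_poly xs) z - poly p z" "poly p z - f z" \<epsilon>] by simp
  qed
qed

section \<open>A maximal dense-lineable space from sums of blocks\<close>

definition dense_orbit :: "(nat \<Rightarrow> complex poly) \<Rightarrow> (complex \<Rightarrow> complex) \<Rightarrow> bool" where
  "dense_orbit P x \<longleftrightarrow> (\<forall>g\<in>entire. \<forall>R \<epsilon>. \<epsilon> > 0 \<longrightarrow>
     (\<exists>n. \<forall>z. norm z \<le> R \<longrightarrow> norm (diff_op (P n) x z - g z) < \<epsilon>))"

lemma dense_orbit_HC: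
  assumes "x \<in> entire" "dense_orbit P x"
  shows "x \<in> HC entire_topology entire_topology (\<lambda>n. diff_op (P n))"
proof -
  have "g \<in> entire_topology closure_of range (\<lambda>n. diff_op (P n) x)" if g: "g \<in> entire" for g
  proof (rule entire_closure_ofI[OF g])
    show "range (\<lambda>n. diff_op (P n) x) \<subseteq> entire" using assms(1) diff_op_entire by blast
    fix R \<epsilon> :: real assume "\<epsilon> > 0"
    then obtain n where "\<forall>z. norm z \<le> R \<longrightarrow> norm (diff_op (P n) x z - g z) < \<epsilon>"
      using assms(2)[unfolded dense_orbit_def, rule_format, OF g] by blast
    then show "\<exists>f\<in>range (\<lambda>n. diff_op (P n) x). \<forall>z\<in>cball 0 R. norm (f z - g z) < \<epsilon>"
      by (intro bexI[of _ "diff_op (P n) x"]) auto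
  qed
  then have "entire_topology closure_of range (\<lambda>n. diff_op (P n) x) = entire"
    using closure_of_subset_topspace[of entire_topology, unfolded topspace_entire_topology] by blast
  then show ?thesis
    unfolding HC_def using assms(1) by simp
qed

lemma not_dense_orbit_zero: "\<not> dense_orbit P (\<lambda>z. 0)"
proof
  assume "dense_orbit P (\<lambda>z. 0)"
  then obtain n where "\<forall>z. norm z \<le> 0 \<longrightarrow> norm (diff_op (P n) (\<lambda>z. 0) z - 1) < 1"
    unfolding dense_orbit_def by (elim ballE[of _ _ "\<lambda>z. 1"] allE[of _ 0] allE[of _ 1]) (auto simp: entire_const)
  then show False by (auto simp: diff_op_zero)
qed

lemma block_sequence:
  fixes P :: "nat \<Rightarrow> complex poly"
  assumes step: "\<And>R \<delta> D q. \<delta> > 0 \<Longrightarrow> \<exists>n u. D \<le> valence (P n) \<and> (\<forall>z. norm z \<le> R \<longrightarrow>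
      norm (poly u z) \<le> \<delta> \<and> norm (diff_op (P n) (poly u) z - poly q z) \<le> \<delta>)"
  obtains N u where
    "\<And>k. k \<le> valence (P (N k))"
    "\<And>j k. j < k \<Longrightarrow> degree (u j) < valence (P (N k))"
    "\<And>k z. norm z \<le> k \<Longrightarrow> norm (poly (u k) z) \<le> (1/2)^k"
    "\<And>k z. norm z \<le> k \<Longrightarrow> norm (diff_op (P (N k)) (poly (u k)) z - poly (q k) z) \<le> (1/2)^k"
    "\<And>j k z. j < k \<Longrightarrow> norm z \<le> k \<Longrightarrow> norm (diff_op (P (N j)) (poly (u k)) z) \<le> (1/2)^k"
proof -
  define Q where "Q f k r \<longleftrightarrow> k \<le> valence (P (fst r)) \<and>
     (\<forall>j<k. degree (snd (f j)) < valence (P (fst r))) \<and>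
     (\<forall>z. norm z \<le> k \<longrightarrow> norm (poly (snd r) z) \<le> (1/2)^k \<and>
         norm (diff_op (P (fst r)) (poly (snd r)) z - poly (q k) z) \<le> (1/2)^k \<and>
         (\<forall>j<k. norm (diff_op (P (fst (f j))) (poly (snd r)) z) \<le> (1/2)^k))"
    for f :: "nat \<Rightarrow> nat \<times> complex poly" and k and r :: "nat \<times> complex poly"
  have "\<exists>f. \<forall>k. Q f k (f k)"
  proof (rule dependent_wellorder_choice)
    fix r :: "nat \<times> complex poly" and f g :: "nat \<Rightarrow> nat \<times> complex poly" and k :: nat
    assume "\<And>j. j < k \<Longrightarrow> f j = g j"
    then show "Q f k r = Q g k r" unfolding Q_def by auto
  next
    fix k :: nat and f :: "nat \<Rightarrow> nat \<times> complex poly"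
    have "\<forall>j. \<exists>C>0. \<forall>h B z. h \<in> entire \<longrightarrow> (\<forall>z. norm z \<le> real k + 1 \<longrightarrow> norm (h z) \<le> B) \<longrightarrow> norm z \<le> real k
        \<longrightarrow> norm (diff_op (P (fst (f j))) h z) \<le> C * B"
    proof
      fix j
      obtain C where "C > 0"
        "\<And>h R B z. h \<in> entire \<Longrightarrow> (\<And>z. norm z \<le> R + 1 \<Longrightarrow> norm (h z) \<le> B) \<Longrightarrow> norm z \<le> R
           \<Longrightarrow> norm (diff_op (P (fst (f j))) h z) \<le> C * B"
        by (rule diff_op_bound[of "P (fst (f j))"]) blast
      then show "\<exists>C>0. \<forall>h B z. h \<in> entire \<longrightarrow> (\<forall>z. norm z \<le> real k + 1 \<longrightarrow> norm (h z) \<le> B) \<longrightarrow> norm z \<le> real k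
        \<longrightarrow> norm (diff_op (P (fst (f j))) h z) \<le> C * B"
        by (intro exI[of _ C] conjI allI impI) blast+
    qed
    then obtain C where "\<forall>j. C j > 0 \<and> (\<forall>h B z. h \<in> entire \<longrightarrow>
        (\<forall>z. norm z \<le> real k + 1 \<longrightarrow> norm (h z) \<le> B) \<longrightarrow> norm z \<le> real k
        \<longrightarrow> norm (diff_op (P (fst (f j))) h z) \<le> C j * B)"
      by (rule choice[THEN exE])
    then have C: "\<And>j. C j > 0" "\<And>j h B z. h \<in> entire \<Longrightarrow>
        (\<And>z. norm z \<le> real k + 1 \<Longrightarrow> norm (h z) \<le> B) \<Longrightarrow> norm z \<le> real k
        \<Longrightarrow> norm (diff_op (P (fst (f j))) h z) \<le> C j * B"
      by simp_all
    define \<delta> :: real where "\<delta> = (1/2)^k / (1 + (\<Sum>j<k. C j))"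
    have S: "(\<Sum>j<k. C j) \<ge> 0" by (intro sum_nonneg) (simp add: C(1) less_imp_le)
    have \<delta>: "\<delta> > 0" unfolding \<delta>_def by (intro divide_pos_pos add_pos_nonneg S) auto
    have \<delta>': "\<delta> \<le> (1/2)^k"
      using frac_le[of "(1/2)^k" "(1/2)^k :: real" 1 "1 + (\<Sum>j<k. C j)"] S unfolding \<delta>_def by simp
    have C\<delta>: "C j * \<delta> \<le> (1/2)^k" if "j < k" for j
    proof -
      have "C j \<le> (\<Sum>j<k. C j)"
        by (rule member_le_sum) (use that C(1) less_imp_le in auto)
      then show ?thesis using S unfolding \<delta>_def by (simp add: divide_simps)
    qed
    obtain n u where nu: "k + Suc (\<Sum>j<k. degree (snd (f j))) \<le> valence (P n)"
      "\<And>z. norm z \<le> real k + 1 \<Longrightarrow> norm (poly u z) \<le> \<delta>"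
      "\<And>z. norm z \<le> real k + 1 \<Longrightarrow> norm (diff_op (P n) (poly u) z - poly (q k) z) \<le> \<delta>"
      using step[OF \<delta>, where R="real k + 1" and q="q k" and D="k + Suc (\<Sum>j<k. degree (snd (f j)))"] by blast
    have "Q f k (n, u)"
      unfolding Q_def fst_conv snd_conv
    proof (intro conjI allI impI)
      show "k \<le> valence (P n)" using nu(1) by linarith
      fix j assume "j < k"
      then have "degree (snd (f j)) \<le> (\<Sum>j<k. degree (snd (f j)))"
        by (intro member_le_sum) auto
      then show "degree (snd (f j)) < valence (P n)" using nu(1) by linarith
    next
      fix z :: complex assume z: "norm z \<le> real k"
      show "norm (poly u z) \<le> (1/2)^k" using nu(2)[of z] z \<delta>' by linarith
      show "norm (diff_op (P n) (poly u) z - poly (q k) z) \<le> (1/2)^k"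
        using nu(3)[of z] z \<delta>' by linarith
      fix j assume j: "j < k"
      have "norm (diff_op (P (fst (f j))) (poly u) z) \<le> C j * \<delta>"
        by (rule C(2)[OF poly_entire nu(2) z])
      then show "norm (diff_op (P (fst (f j))) (poly u) z) \<le> (1/2)^k"
        using C\<delta>[OF j] by linarith
    qed
    then show "\<exists>r. Q f k r" ..
  qed
  then obtain f where f: "\<And>k. Q f k (f k)" by blast
  show ?thesis
    by (rule that[of "\<lambda>k. fst (f k)" "\<lambda>k. snd (f k)"])
      (use f in \<open>auto simp: Q_def\<close>)
qed

definition gap_series :: "(nat \<Rightarrow> complex poly) \<Rightarrow> nat set \<Rightarrow> complex \<Rightarrow> complex" where
  "gap_series u A z = (\<Sum>k. of_bool (k \<in> A) * poly (u k) z)"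

lemma gap_series_uniform_limit:
  assumes u: "\<And>k z. norm z \<le> k \<Longrightarrow> norm (poly (u k) z) \<le> (1/2)^k"
  shows "uniform_limit (cball 0 R) (\<lambda>n z. \<Sum>k<n. of_bool (k \<in> A) * poly (u k) z) (gap_series u A) sequentially"
  unfolding gap_series_def[abs_def]
proof (rule Weierstrass_m_test_ev)
  show "\<forall>\<^sub>F n in sequentially. \<forall>x\<in>cball 0 R. norm (of_bool (n \<in> A) * poly (u n) x) \<le> (1/2)^n"
    using eventually_ge_at_top[of "nat \<lceil>R\<rceil>"]
  proof eventually_elim
    case (elim n)
    then have "R \<le> real n" by linarith
    then show ?case using u[of _ n] by (auto simp: norm_mult)
  qed
qed simp

lemma gap_series_entire:
  assumes u: "\<And>k z. norm z \<le> k \<Longrightarrow> norm (poly (u k) z) \<le> (1/2)^k"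
  shows "gap_series u A \<in> entire"
  unfolding entire_def mem_Collect_eq
proof (rule holomorphic_uniform_sequence)
  fix x :: complex
  have "cball x 1 \<subseteq> cball 0 (norm x + 1)"
  proof
    fix y assume "y \<in> cball x 1"
    then show "y \<in> cball 0 (norm x + 1)"
      using norm_triangle_sub[of y x] by (simp add: dist_norm norm_minus_commute)
  qed
  then show "\<exists>d>0. cball x d \<subseteq> UNIV \<and> uniform_limit (cball x d)
      (\<lambda>n z. \<Sum>k<n. of_bool (k \<in> A) * poly (u k) z) (gap_series u A) sequentially"
    using uniform_limit_on_subset[OF gap_series_uniform_limit[OF u]] zero_less_one by blast
  show "(\<lambda>z. \<Sum>k<n. of_bool (k \<in> A) * poly (u k) z) holomorphic_on UNIV" for n
    by (intro entire_holomorphic entire_sum entire_cmult poly_entire)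
qed simp

lemma sum_half_power_tail: "(\<Sum>j<n. if j < k then 0 else (1/2)^j) \<le> 2 * (1/2::real)^k"
proof -
  have "(\<Sum>j<n. if j < k then 0 else (1/2)^j) = (if n \<le> k then 0 else 2 * (1/2::real)^k - 2 * (1/2)^n)"
    by (induction n) (auto simp: not_le le_Suc_eq not_less less_Suc_eq)
  then show ?thesis by simp
qed

lemma diff_op_gap_series:
  assumes u: "\<And>k z. norm z \<le> k \<Longrightarrow> norm (poly (u k) z) \<le> (1/2)^k"
    and deg: "\<And>j k. j < k \<Longrightarrow> degree (u j) < valence (P (N k))"
    and diag: "\<And>k z. norm z \<le> k \<Longrightarrow> norm (diff_op (P (N k)) (poly (u k)) z - poly (q k) z) \<le> (1/2)^k"
    and upper: "\<And>j k z. j < k \<Longrightarrow> norm z \<le> k \<Longrightarrow> norm (diff_op (P (N j)) (poly (u k)) z) \<le> (1/2)^k"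
    and z: "norm z \<le> real k"
  shows "norm (diff_op (P (N k)) (gap_series u A) z - of_bool (k \<in> A) * poly (q k) z) \<le> 2 * (1/2)^k"
proof (rule field_le_epsilon)
  fix e :: real assume e: "e > 0"
  define s where "s n = (\<lambda>z. \<Sum>k<n. of_bool (k \<in> A) * poly (u k) z)" for n
  define t where "t = of_bool (k \<in> A) * poly (q k) z"
  obtain C where C: "C > 0"
    "\<And>f R B z. f \<in> entire \<Longrightarrow> (\<And>z. norm z \<le> R + 1 \<Longrightarrow> norm (f z) \<le> B) \<Longrightarrow> norm z \<le> R
       \<Longrightarrow> norm (diff_op (P (N k)) f z) \<le> C * B"
    by (rule diff_op_bound[of "P (N k)"]) blast
  have "\<forall>\<^sub>F n in sequentially. \<forall>x\<in>cball 0 (real k + 1). dist (s n x) (gap_series u A x) < e / C"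
    unfolding s_def by (rule uniform_limitD[OF gap_series_uniform_limit[OF u]]) (use e C(1) in auto)
  then have "\<forall>\<^sub>F n in sequentially. n > k \<and> (\<forall>x\<in>cball 0 (real k + 1). dist (s n x) (gap_series u A x) < e / C)"
    using eventually_gt_at_top[of k] by (intro eventually_conj)
  then obtain n where n: "n > k" "\<forall>x\<in>cball 0 (real k + 1). dist (s n x) (gap_series u A x) < e / C"
    using eventually_happens'[OF sequentially_bot] by blast
  have s: "s n \<in> entire" unfolding s_def by (intro entire_sum entire_cmult poly_entire)
  have "norm (diff_op (P (N k)) (\<lambda>z. gap_series u A z - s n z) z) \<le> C * (e / C)"
  proof (rule C(2)[OF _ _ z])
    show "(\<lambda>z. gap_series u A z - s n z) \<in> entire"
      using gap_series_entire[OF u] s by (intro entire_diff)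
    show "norm (gap_series u A w - s n w) \<le> e / C" if "norm w \<le> real k + 1" for w
      using n(2)[rule_format, of w] that by (simp add: dist_norm norm_minus_commute)
  qed
  then have 1: "norm (diff_op (P (N k)) (gap_series u A) z - diff_op (P (N k)) (s n) z) \<le> e"
    using diff_op_diff[OF gap_series_entire[OF u] s] C(1) by simp
  have sn: "diff_op (P (N k)) (s n) z = (\<Sum>j<n. of_bool (j \<in> A) * diff_op (P (N k)) (poly (u j)) z)"
    unfolding s_def by (subst diff_op_sum) (auto simp: diff_op_cmult poly_entire entire_cmult)
  have "diff_op (P (N k)) (s n) z - t
      = (\<Sum>j<n. of_bool (j \<in> A) * diff_op (P (N k)) (poly (u j)) z - (if j = k then t else 0))"
    using n(1) unfolding sn by (simp add: sum_subtractf)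
  also have "norm \<dots> \<le> (\<Sum>j<n. if j < k then 0 else (1/2)^j)"
  proof (rule sum_norm_le)
    fix j
    consider "j < k" | "j = k" | "k < j" by linarith
    then show "norm (of_bool (j \<in> A) * diff_op (P (N k)) (poly (u j)) z - (if j = k then t else 0))
        \<le> (if j < k then 0 else (1/2)^j)"
    proof cases
      case 1
      then show ?thesis using diff_op_poly_eq_0[OF deg[OF 1]] by simp
    next
      case 2
      then show ?thesis using diag[OF z] by (auto simp: t_def)
    next
      case 3
      then show ?thesis using upper[OF 3, of z] z by auto
    qed
  qed
  also have "\<dots> \<le> 2 * (1/2)^k" by (rule sum_half_power_tail)
  finally have 2: "norm (diff_op (P (N k)) (s n) z - t) \<le> 2 * (1/2)^k" .
  show "norm (diff_op (P (N k)) (gap_series u A) z - of_bool (k \<in> A) * poly (q k) z) \<le> 2 * (1/2)^k + e"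
    unfolding t_def[symmetric]
    using norm_triangle_ineq[of "diff_op (P (N k)) (gap_series u A) z - diff_op (P (N k)) (s n) z"
       "diff_op (P (N k)) (s n) z - t"] 1 2 by simp
qed

text \<open>A continuum of almost disjoint sets of indices. The index \<open>k\<close> encodes a triple
  \<open>(l, n, c)\<close>, where \<open>l\<close> numbers the target polynomial of the block \<open>u k\<close>, and \<open>k\<close> lies in
  \<open>branch S\<close> iff \<open>c\<close> encodes the first \<open>n\<close> bits of \<open>S\<close>.\<close>

definition branch :: "nat set \<Rightarrow> nat set" where
  "branch S = {k. case prod_decode (snd (prod_decode k)) of (n, c) \<Rightarrow> c = set_encode (S \<inter> {..<n})}"

lemma branch_separation:
  assumes "finite F" "S \<notin> F"
  obtains k where "K \<le> k" "fst (prod_decode k) = l" "k \<in> branch S" "\<And>T. T \<in> F \<Longrightarrow> k \<notin> branch T"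
proof -
  have "\<forall>T\<in>F. \<exists>m. (m \<in> S) \<noteq> (m \<in> T)" using assms(2) by (metis set_eqI)
  then obtain m where m: "\<And>T. T \<in> F \<Longrightarrow> (m T \<in> S) \<noteq> (m T \<in> T)" by metis
  define n where "n = K + Suc (\<Sum>T\<in>F. m T)"
  define k where "k = prod_encode (l, prod_encode (n, set_encode (S \<inter> {..<n})))"
  show ?thesis
  proof (rule that)
    have "n \<le> k" unfolding k_def by (meson le_prod_encode_1 le_prod_encode_2 order_trans)
    then show "K \<le> k" by (simp add: n_def)
    show "fst (prod_decode k) = l" "k \<in> branch S" by (simp_all add: k_def branch_def)
    fix T assume T: "T \<in> F"
    have "m T \<le> (\<Sum>T\<in>F. m T)" by (rule member_le_sum) (use T assms in auto)
    then have "m T < n" by (simp add: n_def)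
    then have "S \<inter> {..<n} \<noteq> T \<inter> {..<n}" using m[OF T] by blast
    then show "k \<notin> branch T" by (simp add: k_def branch_def set_encode_eq)
  qed
qed

lemma dense_orbit_combination:
  assumes N: "\<And>k. k \<le> valence (P (N k))"
    and x: "\<And>S. x S \<in> entire"
    and T: "\<And>k z S. norm z \<le> real k \<Longrightarrow> norm (diff_op (P (N k)) (x S) z -
        of_bool (k \<in> branch S) * poly (rat_poly (from_nat (fst (prod_decode k)))) z) \<le> 2 * (1/2)^k"
    and F: "finite F" "W \<in> F" "c W \<noteq> 0"
  shows "dense_orbit P (\<lambda>z. (\<Sum>S\<in>F. c S * x S z) + poly p z)"
  unfolding dense_orbit_def
proof (intro ballI allI impI)
  fix g and R \<epsilon> :: real assume g: "g \<in> entire" and \<epsilon>: "\<epsilon> > 0"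
  obtain l where l: "\<And>z. norm z \<le> R \<Longrightarrow>
      norm (poly (rat_poly (from_nat l)) z - inverse (c W) * g z) < \<epsilon> / 2 / norm (c W)"
    using entire_rat_poly_approx[OF entire_cmult[OF g], where \<epsilon>="\<epsilon>/2/norm (c W)"] \<epsilon> F(3) by auto
  define M where "M = (\<Sum>S\<in>F. norm (c S))"
  have "(\<lambda>k. M * (2 * (1/2)^k)) \<longlonglongrightarrow> M * (2 * 0)"
    by (intro tendsto_intros LIMSEQ_power_zero) simp
  then have "\<forall>\<^sub>F k in sequentially. M * (2 * (1/2)^k) < \<epsilon> / 2"
    by (rule order_tendstoD) (use \<epsilon> in simp)
  then obtain K where K: "\<And>k. k \<ge> K \<Longrightarrow> M * (2 * (1/2)^k) < \<epsilon> / 2"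
    unfolding eventually_sequentially by blast
  obtain k where k: "K + nat \<lceil>R\<rceil> + Suc (degree p) \<le> k" "fst (prod_decode k) = l" "k \<in> branch W"
      "\<And>T. T \<in> F - {W} \<Longrightarrow> k \<notin> branch T"
    using branch_separation[of "F - {W}" W] F(1) by blast
  let ?q = "rat_poly (from_nat l)"
  have E: "diff_op (P (N k)) (\<lambda>z. (\<Sum>S\<in>F. c S * x S z) + poly p z)
      = (\<lambda>z. \<Sum>S\<in>F. c S * diff_op (P (N k)) (x S) z)"
  proof -
    have "diff_op (P (N k)) (poly p) = (\<lambda>z. 0)"
      using N[of k] k(1) by (intro diff_op_poly_eq_0) linarith
    then show ?thesis
      using x by (simp add: diff_op_add diff_op_sum diff_op_cmult entire_sum entire_cmult poly_entire)
  qed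
  show "\<exists>n. \<forall>z. norm z \<le> R \<longrightarrow> norm (diff_op (P n) (\<lambda>z. (\<Sum>S\<in>F. c S * x S z) + poly p z) z - g z) < \<epsilon>"
  proof (intro exI[of _ "N k"] allI impI)
    fix z :: complex assume z: "norm z \<le> R"
    then have zk: "norm z \<le> real k" using k(1) by linarith
    have "(\<Sum>S\<in>F. c S * (of_bool (k \<in> branch S) * poly ?q z)) = (\<Sum>S\<in>{W}. c S * (of_bool (k \<in> branch S) * poly ?q z))"
      using F k by (intro sum.mono_neutral_right) auto
    then have "(\<Sum>S\<in>F. c S * diff_op (P (N k)) (x S) z) - c W * poly ?q z
      = (\<Sum>S\<in>F. c S * (diff_op (P (N k)) (x S) z - of_bool (k \<in> branch S) * poly ?q z))"
      using k(3) by (simp add: sum_subtractf right_diff_distrib)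
    also have "norm \<dots> \<le> (\<Sum>S\<in>F. norm (c S) * (2 * (1/2)^k))"
      using T[OF zk, unfolded k(2)] by (intro sum_norm_le) (simp only: norm_mult mult_left_mono norm_ge_zero)
    also have "\<dots> < \<epsilon> / 2"
      using K[of k] k(1) unfolding M_def sum_distrib_right by simp
    finally have 1: "norm ((\<Sum>S\<in>F. c S * diff_op (P (N k)) (x S) z) - c W * poly ?q z) < \<epsilon> / 2" .
    have "norm (c W * poly ?q z - g z) = norm (c W) * norm (poly ?q z - inverse (c W) * g z)"
      unfolding norm_mult[symmetric] right_diff_distrib using F(3) by (simp add: mult.assoc[symmetric])
    also have "\<dots> < norm (c W) * (\<epsilon> / 2 / norm (c W))"
      using l[OF z] F(3) by (intro mult_strict_left_mono) auto
    finally have 2: "norm (c W * poly ?q z - g z) < \<epsilon> / 2" using F(3) by simp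
    show "norm (diff_op (P (N k)) (\<lambda>z. (\<Sum>S\<in>F. c S * x S z) + poly p z) z - g z) < \<epsilon>"
      unfolding E
      using norm_triangle_ineq[of "(\<Sum>S\<in>F. c S * diff_op (P (N k)) (x S) z) - c W * poly ?q z" "c W * poly ?q z - g z"] 1 2
      by simp
  qed
qed

lemma entire_lepoll: "entire \<lesssim> (UNIV :: nat set set)"
proof -
  define \<Phi> where "\<Phi> f = (to_nat :: nat \<times> rat \<times> bool \<Rightarrow> nat) `
     {(j, q, b). of_rat q < (if b then Re else Im) ((deriv ^^ j) f 0)}" for f :: "complex \<Rightarrow> complex"
  have "inj_on \<Phi> entire"
  proof (rule inj_onI)
    fix f g assume fg: "f \<in> entire" "g \<in> entire" and eq: "\<Phi> f = \<Phi> g"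
    have "{(j, q, b). of_rat q < (if b then Re else Im) ((deriv ^^ j) f 0)}
        = {(j, q :: rat, b). of_rat q < (if b then Re else Im) ((deriv ^^ j) g 0)}"
      using eq unfolding \<Phi>_def by (simp add: inj_image_eq_iff)
    then have *: "of_rat q < (if b then Re else Im) ((deriv ^^ j) f 0)
        \<longleftrightarrow> of_rat q < (if b then Re else Im) ((deriv ^^ j) g 0)" for j b and q :: rat
      by (auto simp: set_eq_iff)
    have "a = b" if "\<And>q :: rat. of_rat q < a \<longleftrightarrow> of_rat q < b" for a b :: real
      using that of_rat_dense by (metis less_asym linorder_neq_iff)
    then have "(if b then Re else Im) ((deriv ^^ j) f 0) = (if b then Re else Im) ((deriv ^^ j) g 0)" for j b
      using * by presburger
    from this[where b=True] this[where b=False] have "(deriv ^^ j) f 0 = (deriv ^^ j) g 0" for j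
      by (simp add: complex_eq_iff)
    then show "f = g"
      using holomorphic_fun_eq_on_connected[of f UNIV g 0] fg
      by (auto simp: entire_def fun_eq_iff)
  qed
  then show ?thesis by (auto simp: lepoll_def)
qed

lemma sum_cscale_apply: "(\<Sum>v\<in>t. cscale (a v) (f v)) = (\<lambda>z. \<Sum>v\<in>t. a v * f v z)"
  by (induction t rule: infinite_finite_induct) (auto simp: cscale_def fun_eq_iff)

lemma maximal_dense_lineableI:
  fixes v :: "nat set \<Rightarrow> complex \<Rightarrow> complex"
  assumes v: "\<And>S. v S \<in> entire"
    and comb: "\<And>F c W. finite F \<Longrightarrow> W \<in> F \<Longrightarrow> c W \<noteq> 0 \<Longrightarrow> dense_orbit P (\<lambda>z. \<Sum>S\<in>F. c S * v S z)"
    and dense: "\<And>g R \<epsilon>. g \<in> entire \<Longrightarrow> \<epsilon> > 0 \<Longrightarrow> \<exists>S. \<forall>z\<in>cball 0 R. norm (v S z - g z) < \<epsilon>"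
  shows "maximal_dense_lineable cscale entire_topology
           (HC entire_topology entire_topology (\<lambda>n. diff_op (P n)))"
proof -
  have "inj v"
  proof (rule injI, rule ccontr)
    fix S T assume "v S = v T" "S \<noteq> T"
    then have "(\<lambda>z. \<Sum>U\<in>{S, T}. (if U = S then 1 else -1) * v U z) = (\<lambda>z. 0)" by auto
    moreover have "dense_orbit P (\<lambda>z. \<Sum>U\<in>{S, T}. (if U = S then 1 else -1) * v U z)"
      by (rule comb[of _ S]) auto
    ultimately show False using not_dense_orbit_zero by simp
  qed
  have comb': "dense_orbit P (\<Sum>w\<in>t. cscale (a w) w)"
    if t: "finite t" "t \<subseteq> range v" "w0 \<in> t" "a w0 \<noteq> 0" for t a w0
  proof -
    obtain F where F: "t = v ` F" using t(2) by (auto simp: subset_image_iff)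
    have fin: "finite F"
      by (rule finite_imageD[OF _ inj_on_subset[OF \<open>inj v\<close> subset_UNIV]]) (use t(1) F in simp)
    obtain W where W: "W \<in> F" "w0 = v W" using t(3) unfolding F by (rule imageE)
    have "dense_orbit P (\<lambda>z. \<Sum>S\<in>F. a (v S) * v S z)"
      by (rule comb[OF fin W(1)]) (use t(4) W(2) in simp)
    then show ?thesis
      unfolding sum_cscale_apply F sum.reindex[OF inj_on_subset[OF \<open>inj v\<close> subset_UNIV]] comp_def .
  qed
  have indep: "cfun.independent (range v)"
    unfolding cfun.independent_explicit_module
  proof (intro allI impI, rule ccontr)
    fix t a w
    assume t: "finite t" "t \<subseteq> range v" "(\<Sum>w\<in>t. cscale (a w) w) = 0" "w \<in> t" "a w \<noteq> 0"
    show False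
      using comb'[of t w a, OF t(1,2,4,5)] not_dense_orbit_zero unfolding t(3) by (simp add: zero_fun_def)
  qed
  have M: "cfun.span (range v) \<subseteq> entire"
    by (rule cfun.span_minimal) (use v subspace_entire in auto)
  obtain C where C: "range v \<subseteq> C" "C \<subseteq> entire" "cfun.independent C" "entire \<subseteq> cfun.span C"
    by (rule cfun.maximal_independent_subset_extend[OF _ indep, of entire]) (use v in auto)
  have "C \<lesssim> range v"
  proof -
    have "C \<lesssim> (UNIV :: nat set set)"
      by (rule lepoll_trans[OF subset_imp_lepoll[OF C(2)] entire_lepoll])
    moreover have "(UNIV :: nat set set) \<lesssim> range v"
      unfolding lepoll_def by (intro exI[of _ v]) (simp add: \<open>inj v\<close>)
    ultimately show ?thesis by (rule lepoll_trans)
  qed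
  then have "range v \<approx> C"
    by (rule lepoll_antisym[OF subset_imp_lepoll[OF C(1)]])
  moreover have "cfun.span C = entire"
    using C(4) cfun.span_minimal[OF C(2) subspace_entire] by (rule antisym[rotated])
  ultimately have dim: "same_dim cscale (cfun.span (range v)) entire"
    unfolding same_dim_def using indep C(3) by (intro exI[of _ "range v"] exI[of _ C]) simp
  have "entire_topology closure_of (cfun.span (range v)) = entire"
  proof
    show "entire_topology closure_of (cfun.span (range v)) \<subseteq> entire"
      by (rule closure_of_subset_topspace[of entire_topology, unfolded topspace_entire_topology])
    show "entire \<subseteq> entire_topology closure_of (cfun.span (range v))"
    proof
      fix g assume g: "g \<in> entire"
      show "g \<in> entire_topology closure_of (cfun.span (range v))"
      proof (rule entire_closure_ofI[OF g M])
        fix R \<epsilon> :: real assume "\<epsilon> > 0"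
        then obtain S where S: "\<forall>z\<in>cball 0 R. norm (v S z - g z) < \<epsilon>"
          by (rule dense[OF g, THEN exE])
        show "\<exists>f\<in>cfun.span (range v). \<forall>z\<in>cball 0 R. norm (f z - g z) < \<epsilon>"
          by (rule bexI[of _ "v S"], rule S, rule cfun.span_base, rule rangeI)
      qed
    qed
  qed
  moreover have "cfun.span (range v) \<subseteq> HC entire_topology entire_topology (\<lambda>n. diff_op (P n)) \<union> {0}"
  proof
    fix x assume x: "x \<in> cfun.span (range v)"
    then obtain t a where t: "finite t" "t \<subseteq> range v" "x = (\<Sum>w\<in>t. cscale (a w) w)"
      unfolding cfun.span_explicit mem_Collect_eq by (elim exE conjE)
    show "x \<in> HC entire_topology entire_topology (\<lambda>n. diff_op (P n)) \<union> {0}"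
    proof (cases "\<exists>w0\<in>t. a w0 \<noteq> 0")
      case True
      then obtain w where "w \<in> t" "a w \<noteq> 0" by blast
      then have "dense_orbit P x" unfolding t(3) by (rule comb'[OF t(1,2)])
      then have "x \<in> HC entire_topology entire_topology (\<lambda>n. diff_op (P n))"
        by (rule dense_orbit_HC[OF subsetD[OF M x]])
      then show ?thesis by (rule UnI1)
    next
      case False
      then have "x = 0" unfolding t(3) by (intro sum.neutral) (simp add: cfun.scale_zero_left)
      then show ?thesis by simp
    qed
  qed
  ultimately show ?thesis
    unfolding maximal_dense_lineable_def topspace_entire_topology
    by (intro exI[of _ "cfun.span (range v)"] conjI cfun.subspace_span M dim)
qed

proposition maximal_dense_lineable_HC_diff_op:
  assumes step: "\<And>R \<delta> D q. \<delta> > 0 \<Longrightarrow> \<exists>n u. D \<le> valence (P n) \<and> (\<forall>z. norm z \<le> R \<longrightarrow>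
      norm (poly u z) \<le> \<delta> \<and> norm (diff_op (P n) (poly u) z - poly q z) \<le> \<delta>)"
  shows "maximal_dense_lineable cscale entire_topology
           (HC entire_topology entire_topology (\<lambda>n. diff_op (P n)))"
proof (rule block_sequence[where P=P and q="\<lambda>k. rat_poly (from_nat (fst (prod_decode k)))", OF step])
  let ?q = "\<lambda>k. rat_poly (from_nat (fst (prod_decode k)))"
  fix N u
  assume N: "\<And>k. k \<le> valence (P (N k))"
    and deg: "\<And>j k. j < k \<Longrightarrow> degree (u j) < valence (P (N k))"
    and u: "\<And>k z. norm z \<le> k \<Longrightarrow> norm (poly (u k) z) \<le> (1/2)^k"
    and diag: "\<And>k z. norm z \<le> k \<Longrightarrow> norm (diff_op (P (N k)) (poly (u k)) z - poly (?q k) z) \<le> (1/2)^k"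
    and upper: "\<And>j k z. j < k \<Longrightarrow> norm z \<le> k \<Longrightarrow> norm (diff_op (P (N j)) (poly (u k)) z) \<le> (1/2)^k"
  define x where "x S = gap_series u (branch S)" for S
  have x: "x S \<in> entire" for S unfolding x_def by (rule gap_series_entire[OF u])
  have T: "norm (diff_op (P (N k)) (x S) z - of_bool (k \<in> branch S) * poly (?q k) z) \<le> 2 * (1/2)^k"
    if "norm z \<le> real k" for k z S
    unfolding x_def by (rule diff_op_gap_series[where q="?q"]) (fact u deg diag upper that)+
  have "\<exists>e. e \<noteq> 0 \<and> (\<forall>z\<in>cball 0 (card S). norm (e * x S z) \<le> (1/2)^card S)" for S
  proof -
    have "bounded (x S ` cball 0 (card S))"
      by (intro compact_imp_bounded compact_continuous_image compact_cball
            holomorphic_on_imp_continuous_on entire_holomorphic x)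
    then obtain B where B: "B > 0" "\<And>z. z \<in> cball 0 (card S) \<Longrightarrow> norm (x S z) \<le> B"
      unfolding bounded_pos by auto
    show ?thesis
      by (rule exI[of _ "of_real ((1/2)^card S / B)"])
        (use B in \<open>auto simp: norm_mult norm_divide norm_power divide_simps mult.commute\<close>)
  qed
  then obtain e where e: "\<And>S. e S \<noteq> 0" "\<And>S z. z \<in> cball 0 (card S) \<Longrightarrow> norm (e S * x S z) \<le> (1/2)^card S"
    by metis
  define v where "v S = (\<lambda>z. e S * x S z + poly (?q (card S)) z)" for S
  show ?thesis
  proof (rule maximal_dense_lineableI[of v])
    show "v S \<in> entire" for S unfolding v_def by (intro entire_add entire_cmult x poly_entire)
    show "dense_orbit P (\<lambda>z. \<Sum>S\<in>F. c S * v S z)" if "finite F" "W \<in> F" "c W \<noteq> 0" for F c W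
    proof -
      have "(\<lambda>z. \<Sum>S\<in>F. c S * v S z) = (\<lambda>z. (\<Sum>S\<in>F. (c S * e S) * x S z)
          + poly (\<Sum>S\<in>F. smult (c S) (?q (card S))) z)"
        by (simp add: v_def poly_sum sum.distrib algebra_simps)
      then show ?thesis
        using dense_orbit_combination[where P=P and N=N and x=x and c="\<lambda>S. c S * e S" and W=W, OF N x T that(1,2)]
          that(3) e(1) by (simp only: mult_eq_0_iff simp_thms)
    qed
    fix g and R \<epsilon> :: real assume g: "g \<in> entire" and \<epsilon>: "\<epsilon> > 0"
    obtain l where l: "\<And>z. norm z \<le> R \<Longrightarrow> norm (poly (rat_poly (from_nat l)) z - g z) < \<epsilon> / 2"
      using entire_rat_poly_approx[OF g, of "\<epsilon>/2" R] \<epsilon> by auto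
    obtain K where K: "(1/2) ^ K < \<epsilon> / 2" using real_arch_pow_inv[of "\<epsilon>/2" "1/2"] \<epsilon> by auto
    define j where "j = prod_encode (l, K + nat \<lceil>R\<rceil>)"
    have j: "K + nat \<lceil>R\<rceil> \<le> j" unfolding j_def by (rule le_prod_encode_2)
    have "(1/2) ^ j \<le> (1/2 :: real) ^ K" using j by (intro power_decreasing) auto
    have "norm (v {..<j} z - g z) < \<epsilon>" if z: "z \<in> cball 0 R" for z
    proof -
      have "norm (e {..<j} * x {..<j} z) \<le> (1/2)^card {..<j}"
        by (rule e(2)) (use z j in simp, linarith)
      then have 1: "norm (e {..<j} * x {..<j} z) < \<epsilon> / 2" using K \<open>(1/2) ^ j \<le> (1/2) ^ K\<close> unfolding card_lessThan by linarith
      have "v {..<j} z - g z = e {..<j} * x {..<j} z + (poly (rat_poly (from_nat l)) z - g z)"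
        by (simp add: v_def j_def)
      moreover have "norm \<dots> < \<epsilon>"
        by (rule norm_triangle_lt) (use 1 l[of z] z in \<open>simp only: mem_cball_0, linarith\<close>)
      ultimately show ?thesis by (simp only:)
    qed
    then show "\<exists>S. \<forall>z\<in>cball 0 R. norm (v S z - g z) < \<epsilon>" by blast
  qed
qed

section \<open>Density of exponentials\<close>

locale semi_inner_product = vector_space scale
  for scale :: "complex \<Rightarrow> 'b::ab_group_add \<Rightarrow> 'b" +
  fixes V :: "'b set" and ip :: "'b \<Rightarrow> 'b \<Rightarrow> complex"
  assumes subspace_V: "subspace V"
    and ip_add: "f \<in> V \<Longrightarrow> g \<in> V \<Longrightarrow> h \<in> V \<Longrightarrow> ip (f + g) h = ip f h + ip g h"
    and ip_scale: "f \<in> V \<Longrightarrow> h \<in> V \<Longrightarrow> ip (scale c f) h = c * ip f h"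
    and ip_cnj: "f \<in> V \<Longrightarrow> h \<in> V \<Longrightarrow> ip h f = cnj (ip f h)"
    and ip_nonneg: "f \<in> V \<Longrightarrow> 0 \<le> Re (ip f f)"
begin

lemma V_intros: "f \<in> V \<Longrightarrow> g \<in> V \<Longrightarrow> f - g \<in> V" "f \<in> V \<Longrightarrow> g \<in> V \<Longrightarrow> f + g \<in> V" "f \<in> V \<Longrightarrow> scale c f \<in> V"
  using subspace_V by (auto intro: subspace_diff subspace_add subspace_scale)

lemma ip_diff:
  assumes "f \<in> V" "g \<in> V" "h \<in> V" shows "ip (f - g) h = ip f h - ip g h"
  using ip_add[of "f - g" g h] assms V_intros(1)[of f g] by simp

lemma ip_diff_right:
  assumes "f \<in> V" "g \<in> V" "h \<in> V" shows "ip h (f - g) = ip h f - ip h g"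
  using ip_diff[OF assms] ip_cnj[of "f - g" h] ip_cnj[of f h] ip_cnj[of g h] assms V_intros(1)[of f g] by simp

lemma ip_scale_right:
  assumes "f \<in> V" "h \<in> V" shows "ip h (scale c f) = cnj c * ip h f"
  using ip_scale[OF assms, of c] ip_cnj[of "scale c f" h] ip_cnj[of f h] assms V_intros(3)[of f c] by simp

lemma Re_ip_diff:
  assumes "f \<in> V" "g \<in> V"
  shows "Re (ip (f - g) (f - g)) = Re (ip f f) + Re (ip g g) - 2 * Re (ip f g)"
proof -
  have "ip (f - g) (f - g) = ip f f - ip g f - (ip f g - ip g g)"
    using assms V_intros(1)[of f g] by (simp add: ip_diff_right ip_diff)
  then show ?thesis using ip_cnj[of f g] assms by simp
qed

lemma Re_ip_parallelogram:
  assumes "f \<in> V" "g \<in> V"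
  shows "Re (ip (f - g) (f - g)) + 4 * Re (ip (scale (1/2) (f + g)) (scale (1/2) (f + g)))
      = 2 * Re (ip f f) + 2 * Re (ip g g)"
proof -
  have "f + g = f - scale (-1) g" by simp
  then have "Re (ip (f + g) (f + g)) = Re (ip f f) + Re (ip g g) + 2 * Re (ip f g)"
    using Re_ip_diff[of f "scale (-1) g"] assms V_intros(3)[of g "-1"]
    by (simp only: ip_scale ip_scale_right) simp
  moreover have "ip (scale (1/2) (f + g)) (scale (1/2) (f + g)) = ip (f + g) (f + g) / 4"
    using assms by (simp only: ip_scale ip_scale_right V_intros) simp
  then have "Re (ip (scale (1/2) (f + g)) (scale (1/2) (f + g))) = Re (ip (f + g) (f + g)) / 4"
    by (simp only: Re_divide_numeral)
  ultimately show ?thesis using Re_ip_diff[OF assms] by linarith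
qed

lemma Re_ip_project:
  assumes "f \<in> V" "w \<in> V"
  shows "Re (ip (f - scale (of_real s * ip f w) w) (f - scale (of_real s * ip f w) w))
      = Re (ip f f) - 2 * s * (norm (ip f w))\<^sup>2 + s\<^sup>2 * (norm (ip f w))\<^sup>2 * Re (ip w w)"
proof -
  have 1: "ip f w * cnj (ip f w) = of_real ((norm (ip f w))\<^sup>2)"
    by (rule complex_norm_square[symmetric])
  let ?c = "of_real s * ip f w"
  have "ip (scale ?c w) (scale ?c w) = of_real (s\<^sup>2 * (norm (ip f w))\<^sup>2) * ip w w"
    using assms 1 by (simp add: ip_scale ip_scale_right V_intros power2_eq_square algebra_simps)
  moreover have "ip f (scale ?c w) = of_real (s * (norm (ip f w))\<^sup>2)"
    using assms 1 by (simp add: ip_scale_right algebra_simps)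
  ultimately show ?thesis
    using Re_ip_diff[of f "scale ?c w"] assms V_intros(3)[of w ?c] by simp
qed

lemma Cauchy_Schwarz:
  assumes "f \<in> V" "w \<in> V"
  shows "(norm (ip f w))\<^sup>2 \<le> Re (ip f f) * Re (ip w w)"
proof -
  define p where "p = (norm (ip f w))\<^sup>2"
  have *: "0 \<le> Re (ip f f) - 2 * s * p + s\<^sup>2 * p * Re (ip w w)" for s
    unfolding p_def Re_ip_project[OF assms, symmetric] by (intro ip_nonneg V_intros assms)
  show ?thesis
  proof (cases "Re (ip w w) = 0")
    case True
    have "p = 0"
    proof (rule ccontr)
      assume "p \<noteq> 0"
      then show False using *[of "(Re (ip f f) + 1) / p"] True ip_nonneg[OF assms(1)] by simp
    qed
    then show ?thesis using True by (simp add: p_def)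
  next
    case False
    then have "Re (ip w w) > 0" using ip_nonneg[OF assms(2)] by simp
    then show ?thesis using *[of "1 / Re (ip w w)"] unfolding p_def[symmetric] by (simp add: power2_eq_square field_simps)
  qed
qed

text \<open>Riesz' construction without completeness: for a minimising sequence \<open>s\<close> in \<open>W\<close> the
  functionals \<open>\<lambda>f. ip f (g - s n)\<close> converge, although \<open>s\<close> itself need not.\<close>

lemma separating_functional:
  assumes W: "subspace W" "W \<subseteq> V" and g: "g \<in> V"
    and d: "\<delta> > 0" "\<And>w. w \<in> W \<Longrightarrow> \<delta> \<le> Re (ip (g - w) (g - w))"
  obtains L :: "'b \<Rightarrow> complex" and C where
    "\<And>f h. f \<in> V \<Longrightarrow> h \<in> V \<Longrightarrow> L (f + h) = L f + L h"
    "\<And>f c. f \<in> V \<Longrightarrow> L (scale c f) = c * L f"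
    "\<And>f. f \<in> V \<Longrightarrow> norm (L f) \<le> C * sqrt (Re (ip f f))"
    "\<And>w. w \<in> W \<Longrightarrow> L w = 0"
    "L g \<noteq> 0"
proof -
  define N where "N f = Re (ip f f)" for f
  define d where "d = (INF w\<in>W. N (g - w))"
  have W0: "0 \<in> W" using W(1) subspace_0 by blast
  have bdd: "bdd_below ((\<lambda>w. N (g - w)) ` W)"
    using d(2) unfolding N_def by (intro bdd_belowI2[of _ \<delta>])
  have d_le: "d \<le> N (g - w)" if "w \<in> W" for w
    unfolding d_def by (rule cINF_lower[OF bdd that])
  have "\<delta> \<le> d"
    unfolding d_def using W0 d(2) by (intro cINF_greatest) (auto simp: N_def)
  with d(1) have d_pos: "d > 0" by simp
  have "\<exists>w\<in>W. N (g - w) < d + 1 / real (Suc n)" for n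
  proof -
    have "(INF w\<in>W. N (g - w)) < d + 1 / real (Suc n)" by (simp add: d_def[symmetric])
    then show ?thesis using W0 by (subst (asm) cINF_less_iff[OF _ bdd]) auto
  qed
  then obtain s where s: "\<And>n. s n \<in> W" "\<And>n. N (g - s n) < d + 1 / real (Suc n)" by metis
  define h where "h n = g - s n" for n
  have sV: "s n \<in> V" for n using s(1) W(2) by blast
  have hV: "h n \<in> V" for n unfolding h_def by (intro V_intros g sV)
  have hN: "N (h n) < d + 1 / real (Suc n)" "d \<le> N (h n)" for n
    using s d_le by (simp_all add: h_def)
  have hdiff: "N (h n - h m) \<le> 2 / real (Suc n) + 2 / real (Suc m)" for n m
  proof -
    have "scale (1/2) (h n + h m) = g - scale (1/2) (s n + s m)"
    proof -
      have "scale (1/2) g + scale (1/2) g = g" by (simp flip: scale_left_distrib)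
      then show ?thesis by (simp add: h_def scale_right_distrib scale_right_diff_distrib algebra_simps)
    qed
    moreover have "scale (1/2) (s n + s m) \<in> W" using s(1) W(1) by (intro subspace_scale subspace_add)
    ultimately have "d \<le> N (scale (1/2) (h n + h m))" using d_le by simp
    moreover have "2 / real (Suc k) = 2 * (1 / real (Suc k))" for k by simp
    ultimately show ?thesis
      using Re_ip_parallelogram[OF hV[of n] hV[of m]] hN(1)[of n] hN(1)[of m] unfolding N_def by linarith
  qed
  have ip_h: "norm (ip f (h n) - ip f (h m)) \<le> sqrt (N f * (2 / real (Suc n) + 2 / real (Suc m)))"
    if "f \<in> V" for f n m
  proof (rule real_le_rsqrt)
    have "(norm (ip f (h n) - ip f (h m)))\<^sup>2 \<le> N f * N (h n - h m)"
      using Cauchy_Schwarz[OF that, of "h n - h m"] that hV by (simp add: ip_diff_right V_intros N_def)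
    also have "\<dots> \<le> N f * (2 / real (Suc n) + 2 / real (Suc m))"
      using hdiff ip_nonneg[OF that] by (intro mult_left_mono) (auto simp: N_def)
    finally show "(norm (ip f (h n) - ip f (h m)))\<^sup>2 \<le> N f * (2 / real (Suc n) + 2 / real (Suc m))" .
  qed
  have conv: "convergent (\<lambda>n. ip f (h n))" if f: "f \<in> V" for f
  proof (rule Cauchy_convergent, rule CauchyI)
    fix e :: real assume e: "e > 0"
    obtain M where M: "N f * 4 / e\<^sup>2 < real M" using reals_Archimedean2 by blast
    show "\<exists>M. \<forall>m\<ge>M. \<forall>n\<ge>M. norm (ip f (h m) - ip f (h n)) < e"
    proof (intro exI[of _ M] allI impI)
      fix m n assume mn: "m \<ge> M" "n \<ge> M"
      have "N f * (2 / real (Suc m) + 2 / real (Suc n)) \<le> N f * (2 / real (Suc M) + 2 / real (Suc M))"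
        using mn ip_nonneg[OF f] by (intro mult_left_mono add_mono divide_left_mono) (auto simp: N_def)
      also have "\<dots> = N f * 4 / real (Suc M)" by simp
      also have "\<dots> < e\<^sup>2"
      proof -
        have "N f * 4 / e\<^sup>2 < real (Suc M)" using M by simp
        then show ?thesis using e by (simp add: divide_less_eq mult.commute)
      qed
      finally have "sqrt (N f * (2 / real (Suc m) + 2 / real (Suc n))) < e"
        using e by (simp add: real_less_lsqrt)
      then show "norm (ip f (h m) - ip f (h n)) < e" using ip_h[OF f, of m n] by linarith
    qed
  qed
  define L where "L f = lim (\<lambda>n. ip f (h n))" for f
  have L: "(\<lambda>n. ip f (h n)) \<longlonglongrightarrow> L f" if "f \<in> V" for f
    using conv[OF that] unfolding L_def by (simp add: convergent_LIMSEQ_iff)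
  have L_add: "L (f + f') = L f + L f'" if "f \<in> V" "f' \<in> V" for f f'
  proof (rule LIMSEQ_unique[OF L])
    show "(\<lambda>n. ip (f + f') (h n)) \<longlonglongrightarrow> L f + L f'"
      using tendsto_add[OF L[OF that(1)] L[OF that(2)]] that hV by (simp add: ip_add)
  qed (intro V_intros that)
  have L_scale: "L (scale c f) = c * L f" if "f \<in> V" for f c
  proof (rule LIMSEQ_unique[OF L])
    show "(\<lambda>n. ip (scale c f) (h n)) \<longlonglongrightarrow> c * L f"
      using tendsto_mult_left[OF L[OF that], of c] that hV by (simp add: ip_scale)
  qed (intro V_intros that)
  have L_bound: "norm (L f) \<le> sqrt (d + 1) * sqrt (N f)" if f: "f \<in> V" for f
  proof (rule LIMSEQ_le_const2[OF tendsto_norm[OF L[OF f]]], intro exI[of _ 0] allI impI)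
    fix n
    have "1 / real (Suc n) \<le> 1" by simp
    then have "N (h n) \<le> d + 1" using hN(1)[of n] by linarith
    then have "N f * N (h n) \<le> N f * (d + 1)"
      using ip_nonneg[OF f] by (intro mult_left_mono) (auto simp: N_def)
    then have "(norm (ip f (h n)))\<^sup>2 \<le> (d + 1) * N f"
      using Cauchy_Schwarz[OF f hV[of n]] by (simp add: N_def mult.commute)
    then have "norm (ip f (h n)) \<le> sqrt ((d + 1) * N f)" by (rule real_le_rsqrt)
    then show "norm (ip f (h n)) \<le> sqrt (d + 1) * sqrt (N f)" by (simp add: real_sqrt_mult)
  qed
  have L_W: "L w = 0" if w: "w \<in> W" for w
  proof (rule LIMSEQ_unique[OF L])
    show wV: "w \<in> V" using w W(2) by blast
    have "norm (ip w (h n)) \<le> sqrt ((1 + N w) * (1 / real (Suc n)))" for n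
    proof (rule real_le_rsqrt)
      define p where "p = (norm (ip (h n) w))\<^sup>2"
      define r where "r = 1 / (1 + N w)"
      have Nw: "N w \<ge> 0" using ip_nonneg[OF wV] by (simp add: N_def)
      have r: "r > 0" "r * N w \<le> 1" using Nw by (auto simp: r_def)
      have "d \<le> N (h n - scale (of_real r * ip (h n) w) w)"
      proof -
        have "h n - scale (of_real r * ip (h n) w) w = g - (s n + scale (of_real r * ip (h n) w) w)"
          by (simp add: h_def algebra_simps)
        moreover have "s n + scale (of_real r * ip (h n) w) w \<in> W"
          using s(1) w W(1) by (intro subspace_add subspace_scale)
        ultimately show ?thesis using d_le by (simp only:)
      qed
      then have "d \<le> N (h n) - 2 * r * p + r\<^sup>2 * p * N w"
        using Re_ip_project[OF hV wV, of n r] by (simp add: N_def p_def)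
      moreover have "r\<^sup>2 * p * N w \<le> r * p"
        using mult_left_mono[OF r(2), of "r * p"] r(1) by (simp add: p_def power2_eq_square mult_ac)
      ultimately have "r * p \<le> 1 / real (Suc n)" using hN(1)[of n] by linarith
      then have "p \<le> (1 + N w) * (1 / real (Suc n))"
        using Nw unfolding r_def by (simp add: field_simps)
      moreover have "norm (ip w (h n)) = norm (ip (h n) w)"
        using ip_cnj[OF hV wV, of n] by simp
      ultimately show "(norm (ip w (h n)))\<^sup>2 \<le> (1 + N w) * (1 / real (Suc n))" by (simp add: p_def)
    qed
    then have E: "\<forall>\<^sub>F n in sequentially. norm (ip w (h n)) \<le> sqrt ((1 + N w) * (1 / real (Suc n)))"
      by (intro always_eventually allI)
    have T: "(\<lambda>n. sqrt ((1 + N w) * (1 / real (Suc n)))) \<longlonglongrightarrow> sqrt ((1 + N w) * 0)"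
      by (intro tendsto_real_sqrt tendsto_mult tendsto_const LIMSEQ_Suc[OF lim_1_over_n])
    show "(\<lambda>n. ip w (h n)) \<longlonglongrightarrow> 0"
      by (rule Lim_null_comparison[OF E]) (use T in simp)
  qed
  have "L g \<noteq> 0"
  proof
    assume "L g = 0"
    obtain m where m: "1 / d < real m" using reals_Archimedean2 by blast
    have "g = h m + s m" by (simp add: h_def)
    then have "L (h m) = 0" using L_add[OF hV[of m] sV[of m]] L_W[OF s(1)[of m]] \<open>L g = 0\<close> by simp
    then have Z: "(\<lambda>n. Re (ip (h m) (h n))) \<longlonglongrightarrow> 0" using tendsto_Re[OF L[OF hV[of m]]] by simp
    have Y: "(\<lambda>n. d - 1 / real (Suc n) - 1 / real (Suc m)) \<longlonglongrightarrow> d - 0 - 1 / real (Suc m)"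
      by (intro tendsto_diff tendsto_const LIMSEQ_Suc[OF lim_1_over_n])
    have X: "d - 1 / real (Suc n) - 1 / real (Suc m) \<le> Re (ip (h m) (h n))" for n

    proof -
      have "2 / real (Suc k) = 2 * (1 / real (Suc k))" for k by simp
      then show ?thesis
        using Re_ip_diff[OF hV[of m] hV[of n]] hdiff[of m n] hN(2)[of m] hN(2)[of n] unfolding N_def by linarith
    qed
    have "d - 0 - 1 / real (Suc m) \<le> 0"
      by (rule LIMSEQ_le[OF Y Z], rule exI[of _ 0], intro allI impI, rule X)
    moreover have "1 / real (Suc m) < d"
    proof -
      have "1 / d < real (Suc m)" using m by simp
      then show ?thesis using d_pos by (simp add: divide_less_eq mult.commute)
    qed
    ultimately show False by simp
  qed
  show ?thesis
    by (rule that[of L "sqrt (d + 1)"])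
      (erule (1) L_add, erule L_scale, erule L_bound[unfolded N_def], erule L_W, rule \<open>L g \<noteq> 0\<close>)
qed

end

definition circle_ip :: "real \<Rightarrow> (complex \<Rightarrow> complex) \<Rightarrow> (complex \<Rightarrow> complex) \<Rightarrow> complex" where
  "circle_ip \<rho> f h = integral {0..1} (\<lambda>t. f (circlepath 0 \<rho> t) * cnj (h (circlepath 0 \<rho> t)))"

lemma continuous_on_entire_circlepath:
  assumes "f \<in> entire"
  shows "continuous_on {0..1} (\<lambda>t. f (circlepath 0 \<rho> t))"
  using continuous_on_compose2[OF holomorphic_on_imp_continuous_on[OF entire_holomorphic[OF assms, of UNIV]],
      of "{0..1}" "circlepath 0 \<rho>"] path_circlepath[of 0 \<rho>] unfolding path_def by simp

lemma circle_ip_integrable: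
  assumes "f \<in> entire" "h \<in> entire"
  shows "(\<lambda>t. f (circlepath 0 \<rho> t) * cnj (h (circlepath 0 \<rho> t))) integrable_on {0..1}"
  by (intro integrable_continuous_interval continuous_intros continuous_on_entire_circlepath assms)

lemma Re_circle_ip:
  assumes "f \<in> entire"
  shows "((\<lambda>t. (norm (f (circlepath 0 \<rho> t)))\<^sup>2) has_integral Re (circle_ip \<rho> f f)) {0..1}"
  using has_integral_Re[OF integrable_integral[OF circle_ip_integrable[OF assms assms, of \<rho>]]]
  unfolding circle_ip_def complex_norm_square[symmetric] Re_complex_of_real .

interpretation circle: semi_inner_product cscale entire "circle_ip \<rho>" for \<rho>
proof
  show "cfun.subspace entire" by (rule subspace_entire)
  fix f g h :: "complex \<Rightarrow> complex" and c
  show "circle_ip \<rho> (f + g) h = circle_ip \<rho> f h + circle_ip \<rho> g h" if "f \<in> entire" "g \<in> entire" "h \<in> entire"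
    unfolding circle_ip_def
    using integral_add[OF circle_ip_integrable[OF that(1,3)] circle_ip_integrable[OF that(2,3)]]
    by (simp add: distrib_right)
  show "circle_ip \<rho> (cscale c f) h = c * circle_ip \<rho> f h" if "f \<in> entire" "h \<in> entire"
    unfolding circle_ip_def cscale_def by (simp add: mult.assoc)
  show "circle_ip \<rho> h f = cnj (circle_ip \<rho> f h)" if "f \<in> entire" "h \<in> entire"
    unfolding circle_ip_def integral_cnj by (simp add: mult.commute)
  show "0 \<le> Re (circle_ip \<rho> f f)" if "f \<in> entire"
    by (rule has_integral_nonneg[OF Re_circle_ip[OF that]]) simp
qed

lemma circle_ip_upper:
  assumes "f \<in> entire" "\<rho> > 0" "B \<ge> 0" "\<And>z. norm z \<le> \<rho> \<Longrightarrow> norm (f z) \<le> B"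
  shows "sqrt (Re (circle_ip \<rho> f f)) \<le> B"
proof -
  have "norm (circlepath 0 \<rho> t) = \<rho>" for t using assms(2) by (simp add: circlepath norm_mult)
  then have "(norm (f (circlepath 0 \<rho> t)))\<^sup>2 \<le> B\<^sup>2" for t
    using assms(4)[of "circlepath 0 \<rho> t"] by (intro power_mono) auto
  moreover have "((\<lambda>t. B\<^sup>2) has_integral B\<^sup>2) {0..1::real}" using has_integral_const_real[of "B\<^sup>2" 0 1] by simp
  ultimately have "Re (circle_ip \<rho> f f) \<le> B\<^sup>2"
    by (intro has_integral_le[OF Re_circle_ip[OF assms(1)]]) auto
  then show ?thesis using assms(3) by (rule real_le_lsqrt[rotated 1])
qed

text \<open>Cauchy's formula is applied to \<open>f\<^sup>2\<close>, which makes a Cauchy-Schwarz inequality for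
  the integral over the circle unnecessary.\<close>

lemma circle_ip_lower:
  assumes f: "f \<in> entire" and z: "norm z \<le> \<rho> - 1"
  shows "(norm (f z))\<^sup>2 \<le> \<rho> * Re (circle_ip \<rho> f f)"
proof -
  have \<rho>: "\<rho> > 0" using z norm_ge_zero[of z] by linarith
  let ?c = "circlepath 0 \<rho>"
  have "((\<lambda>u. (f u)\<^sup>2 / (u - z)) has_contour_integral (2 * of_real pi * \<i> * (f z)\<^sup>2)) ?c"
    by (rule Cauchy_integral_circlepath_simple) (use z holomorphic_on_power[OF entire_holomorphic[OF f]] in auto)
  then have I: "((\<lambda>t. (f (?c t))\<^sup>2 / (?c t - z) * vector_derivative ?c (at t within {0..1})) has_integral
      (2 * of_real pi * \<i> * (f z)\<^sup>2)) {0..1}"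
    unfolding has_contour_integral_def .
  have "norm (integral {0..1} (\<lambda>t. (f (?c t))\<^sup>2 / (?c t - z) * vector_derivative ?c (at t within {0..1})))
      \<le> integral {0..1} (\<lambda>t. 2 * pi * \<rho> * (norm (f (?c t)))\<^sup>2)"
  proof (rule integral_norm_bound_integral)
    show "(\<lambda>t. (f (?c t))\<^sup>2 / (?c t - z) * vector_derivative ?c (at t within {0..1})) integrable_on {0..1}"
      using I by (rule has_integral_integrable)
    show "(\<lambda>t. 2 * pi * \<rho> * (norm (f (?c t)))\<^sup>2) integrable_on {0..1}"
      by (rule has_integral_integrable[OF has_integral_mult_right[OF Re_circle_ip[OF f]]])
    fix t :: real assume t: "t \<in> {0..1}"
    have "norm (?c t) = \<rho>" using \<rho> by (simp add: circlepath norm_mult)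
    then have "1 \<le> norm (?c t - z)" using z norm_triangle_ineq2[of "?c t" z] by linarith
    then have "(norm (f (?c t)))\<^sup>2 / norm (?c t - z) \<le> (norm (f (?c t)))\<^sup>2 / 1"
      by (intro divide_left_mono) auto
    then have "(norm (f (?c t)))\<^sup>2 / norm (?c t - z) * (2 * pi * \<rho>) \<le> (norm (f (?c t)))\<^sup>2 / 1 * (2 * pi * \<rho>)"
      by (rule mult_right_mono) (use \<rho> in simp)
    moreover have "norm (vector_derivative ?c (at t within {0..1})) = 2 * pi * \<rho>"
      using t \<rho> by (simp add: vector_derivative_circlepath01 norm_mult)
    ultimately show "norm ((f (?c t))\<^sup>2 / (?c t - z) * vector_derivative ?c (at t within {0..1}))
        \<le> 2 * pi * \<rho> * (norm (f (?c t)))\<^sup>2"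
      unfolding norm_mult norm_divide norm_power by (simp only: div_by_1 mult.commute)
  qed
  also have "\<dots> = 2 * pi * \<rho> * Re (circle_ip \<rho> f f)"
    by (rule integral_unique[OF has_integral_mult_right[OF Re_circle_ip[OF f]]])
  finally have "2 * pi * (norm (f z))\<^sup>2 \<le> 2 * pi * (\<rho> * Re (circle_ip \<rho> f f))"
    unfolding integral_unique[OF I] by (simp add: norm_mult norm_power)
  then show ?thesis by simp
qed

lemma higher_deriv_exp_linear: "(deriv ^^ j) (\<lambda>z. exp (a * z)) = (\<lambda>z. a ^ j * exp (a * z :: complex))"
proof (induction j)
  case (Suc j)
  have "deriv (\<lambda>z. a ^ j * exp (a * z)) z = a ^ Suc j * exp (a * z)" for z
    by (rule DERIV_imp_deriv) (auto intro!: derivative_eq_intros)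
  then show ?case by (simp add: Suc)
qed simp

lemma powser_sums_zero_coeff:
  fixes a :: "nat \<Rightarrow> complex"
  assumes "\<And>x. (\<lambda>n. a n * x ^ n) sums 0"
  shows "a m = 0"
proof (cases "m = 0")
  case True
  have "(\<lambda>n. a n * 0 ^ n) sums a 0" by (rule powser_sums_zero)
  then show ?thesis using sums_unique2[OF assms[of 0]] True by simp
next
  case False
  show ?thesis
  proof (rule ccontr)
    assume "a m \<noteq> 0"
    then obtain s where "0 < s" "\<And>z::complex. z \<in> cball 0 s - {0} \<Longrightarrow> (0::complex) \<noteq> 0"
      using powser_0_nonzero[of 1 0 a "\<lambda>x. 0" m] assms False by auto
    from this(2)[of "of_real s"] this(1) show False by simp
  qed
qed

proposition dense_span_exp:
  assumes U: "exp_unicity_set U" and g: "g \<in> entire" and \<epsilon>: "\<epsilon> > 0"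
  shows "\<exists>y\<in>cfun.span ((\<lambda>a z. exp (a * z)) ` U). \<forall>z. norm z \<le> R \<longrightarrow> norm (y z - g z) < \<epsilon>"
proof (rule ccontr)
  let ?W = "cfun.span ((\<lambda>a z. exp (a * z)) ` U)"
  let ?e = "\<lambda>a z. exp (a * z) :: complex"
  assume "\<not> ?thesis"
  then have far: "\<exists>z. norm z \<le> R \<and> norm (y z - g z) \<ge> \<epsilon>" if "y \<in> ?W" for y
    using that by (meson not_le)
  define \<rho> where "\<rho> = \<bar>R\<bar> + 1"
  have \<rho>: "\<rho> > 0" by (simp add: \<rho>_def)
  have W: "?W \<subseteq> entire"
    by (rule cfun.span_minimal) (auto simp: entire_exp subspace_entire)
  have dist: "\<epsilon>\<^sup>2 / \<rho> \<le> Re (circle_ip \<rho> (g - w) (g - w))" if w: "w \<in> ?W" for w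
  proof -
    obtain z where z: "norm z \<le> R" "norm (w z - g z) \<ge> \<epsilon>" using far[OF w] by blast
    have "g - w \<in> entire" using g w W by (intro circle.V_intros) auto
    then have "(norm ((g - w) z))\<^sup>2 \<le> \<rho> * Re (circle_ip \<rho> (g - w) (g - w))"
      by (rule circle_ip_lower) (use z in \<open>simp add: \<rho>_def\<close>)
    moreover have "\<epsilon>\<^sup>2 \<le> (norm ((g - w) z))\<^sup>2"
      using z(2) \<epsilon> by (intro power_mono) (auto simp: norm_minus_commute)
    ultimately show ?thesis using \<rho> by (simp add: divide_le_eq mult.commute)
  qed
  have pos: "\<epsilon>\<^sup>2 / \<rho> > 0" using \<epsilon> \<rho> by simp
  show False
  proof (rule circle.separating_functional[OF cfun.subspace_span W g pos dist])
    fix L C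
    assume L_add: "\<And>f h. f \<in> entire \<Longrightarrow> h \<in> entire \<Longrightarrow> L (f + h) = L f + L h"
      and L_scale: "\<And>f c. f \<in> entire \<Longrightarrow> L (cscale c f) = c * L f"
      and L_bound: "\<And>f. f \<in> entire \<Longrightarrow> norm (L f) \<le> C * sqrt (Re (circle_ip \<rho> f f))"
      and L_W: "\<And>w. w \<in> ?W \<Longrightarrow> L w = 0" and L_g: "L g \<noteq> 0"
    have L_sup: "norm (L f) \<le> (\<bar>C\<bar> + 1) * B"
      if "f \<in> entire" "B \<ge> 0" "\<And>z. norm z \<le> \<rho> \<Longrightarrow> norm (f z) \<le> B" for f B
    proof -
      have "C * sqrt (Re (circle_ip \<rho> f f)) \<le> (\<bar>C\<bar> + 1) * sqrt (Re (circle_ip \<rho> f f))"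
        by (intro mult_right_mono real_sqrt_ge_zero circle.ip_nonneg that) simp
      also have "\<dots> \<le> (\<bar>C\<bar> + 1) * B"
        using circle_ip_upper[OF that(1) \<rho> that(2,3)] by (intro mult_left_mono) auto
      finally show ?thesis using L_bound[OF that(1)] by linarith
    qed
    define \<mu> where "\<mu> k = L (\<lambda>z. z ^ k)" for k
    have pw: "(\<lambda>z. z ^ k) \<in> entire" for k :: nat by (simp add: entire_def holomorphic_intros)
    have L_partial: "L (\<lambda>z. \<Sum>i<n. a i * z ^ i) = (\<Sum>i<n. a i * \<mu> i)" for a :: "nat \<Rightarrow> complex" and n
    proof (induction n)
      case 0
      have "L (cscale 0 (\<lambda>z. z ^ 0)) = 0 * L (\<lambda>z. z ^ 0)" by (intro L_scale pw)
      then show ?case by (simp add: cscale_def)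
    next
      case (Suc n)
      have "(\<lambda>z. \<Sum>i<Suc n. a i * z ^ i) = (\<lambda>z. \<Sum>i<n. a i * z ^ i) + cscale (a n) (\<lambda>z. z ^ n)"
        by (simp add: cscale_def plus_fun_def)
      then show ?case
        using L_add[of "\<lambda>z. \<Sum>i<n. a i * z ^ i" "cscale (a n) (\<lambda>z. z ^ n)"] L_scale[OF pw, of "a n" n] Suc
        by (simp add: entire_sum entire_cmult pw circle.V_intros \<mu>_def)
    qed
    have L_sums: "(\<lambda>i. (deriv ^^ i) f 0 / fact i * \<mu> i) sums L f" if f: "f \<in> entire" for f
      unfolding sums_def
    proof (rule tendstoI)
      fix e :: real assume e: "e > 0"
      let ?s = "\<lambda>n z. \<Sum>i<n. (deriv ^^ i) f 0 / fact i * z ^ i"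
      have s: "?s n \<in> entire" for n by (intro entire_sum entire_cmult pw)
      have "\<forall>\<^sub>F n in sequentially. \<forall>z\<in>cball 0 \<rho>. dist (?s n z) (f z) < e / (2 * (\<bar>C\<bar> + 1))"
        by (rule uniform_limitD[OF entire_Taylor_uniform_limit[OF f]]) (use e in \<open>simp add: add_nonneg_pos\<close>)
      then show "\<forall>\<^sub>F n in sequentially. dist (\<Sum>i<n. (deriv ^^ i) f 0 / fact i * \<mu> i) (L f) < e"
      proof eventually_elim
        case (elim n)
        have "norm (L (?s n - f)) \<le> (\<bar>C\<bar> + 1) * (e / (2 * (\<bar>C\<bar> + 1)))"
        proof (rule L_sup)
          show "?s n - f \<in> entire" by (intro circle.V_intros s f)
          show "norm ((?s n - f) z) \<le> e / (2 * (\<bar>C\<bar> + 1))" if "norm z \<le> \<rho>" for z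
            using elim[rule_format, of z] that by (simp add: dist_norm less_imp_le)
        qed (use e in simp)
        also have "\<dots> = e / 2" by (simp add: add_nonneg_pos field_simps)
        also have "\<dots> < e" using e by simp
        also have "L (?s n - f) = L (?s n) - L f"
          using L_add[of "?s n - f" f] circle.V_intros(1)[OF s f] f by simp
        finally show ?case unfolding L_partial dist_norm .
      qed
    qed
    define \<Phi> where "\<Phi> a = L (?e a)" for a
    have \<Phi>_sums: "(\<lambda>k. \<mu> k / fact k * a ^ k) sums \<Phi> a" for a
      using L_sums[OF entire_exp, of a] unfolding higher_deriv_exp_linear \<Phi>_def by (simp add: mult.commute)
    have "\<Phi> holomorphic_on ball 0 r" for r
      by (rule power_series_holomorphic[where a="\<lambda>k. \<mu> k / fact k"]) (use \<Phi>_sums in simp)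
    then have "\<Phi> holomorphic_on (\<Union>n. ball 0 (real n))" by (intro holomorphic_on_UN_open) auto
    moreover have "(\<Union>n. ball 0 (real n)) = (UNIV :: complex set)"
      using reals_Archimedean2 by (auto simp: set_eq_iff)
    ultimately have \<Phi>_entire: "\<Phi> \<in> entire" by (simp add: entire_def)
    have \<Phi>_bound: "norm (\<Phi> a) \<le> (\<bar>C\<bar> + 1) * exp (\<rho> * norm a)" for a
      unfolding \<Phi>_def
    proof (rule L_sup)
      fix z :: complex assume "norm z \<le> \<rho>"
      then have "norm (a * z) \<le> \<rho> * norm a" by (simp add: norm_mult mult.commute[of \<rho>] mult_left_mono)
      then show "norm (exp (a * z)) \<le> exp (\<rho> * norm a)"
        using norm_exp[of "a * z"] by (meson exp_le_cancel_iff order_trans)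
    qed (simp_all add: entire_exp)
    have "\<Phi> \<in> exponential_type"
      unfolding exponential_type_def mem_Collect_eq
      by (rule conjI, rule \<Phi>_entire, rule exI[of _ "\<bar>C\<bar> + 1"], rule conjI, linarith,
          rule exI[of _ \<rho>], rule conjI, rule \<rho>, rule allI, rule \<Phi>_bound)
    moreover have "\<Phi> a = 0" if "a \<in> U" for a
      unfolding \<Phi>_def using that by (intro L_W cfun.span_base imageI)
    ultimately have "\<Phi> a = 0" for a using U unfolding exp_unicity_set_def by blast
    then have "\<mu> k / fact k = 0" for k using powser_sums_zero_coeff[of "\<lambda>k. \<mu> k / fact k" k] \<Phi>_sums by simp
    then have "\<mu> k = 0" for k by simp
    then have "L g = 0" using L_sums[OF g] by (simp add: sums_iff)
    with L_g show False ..
  qed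
qed

section \<open>Null sequences mapped close to a given function\<close>

definition loc_uniform_limit :: "nat filter \<Rightarrow> (nat \<Rightarrow> complex \<Rightarrow> complex) \<Rightarrow> (complex \<Rightarrow> complex) \<Rightarrow> bool" where
  "loc_uniform_limit F f g \<longleftrightarrow>
     (\<forall>R \<epsilon>. \<epsilon> > 0 \<longrightarrow> (\<forall>\<^sub>F n in F. \<forall>z. norm z \<le> R \<longrightarrow> norm (f n z - g z) < \<epsilon>))"

lemma loc_uniform_limitD:
  "loc_uniform_limit F f g \<Longrightarrow> \<epsilon> > 0 \<Longrightarrow> \<forall>\<^sub>F n in F. \<forall>z. norm z \<le> R \<longrightarrow> norm (f n z - g z) < \<epsilon>"
  unfolding loc_uniform_limit_def by simp

lemma loc_uniform_limit_add:
  assumes "loc_uniform_limit F f g" "loc_uniform_limit F f' g'"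
  shows "loc_uniform_limit F (\<lambda>n z. f n z + f' n z) (\<lambda>z. g z + g' z)"
  unfolding loc_uniform_limit_def
proof (intro allI impI)
  fix R \<epsilon> :: real assume "\<epsilon> > 0"
  then have "\<epsilon> / 2 > 0" by simp
  from loc_uniform_limitD[OF assms(1) this, of R] loc_uniform_limitD[OF assms(2) this, of R]
  show "\<forall>\<^sub>F n in F. \<forall>z. norm z \<le> R \<longrightarrow> norm (f n z + f' n z - (g z + g' z)) < \<epsilon>"
  proof eventually_elim
    case (elim n)
    show ?case
    proof (intro allI impI)
      fix z :: complex assume z: "norm z \<le> R"
      have "f n z + f' n z - (g z + g' z) = (f n z - g z) + (f' n z - g' z)" by simp
      moreover have "norm \<dots> < \<epsilon>"
        by (rule norm_triangle_lt) (use elim[rule_format, OF z] in linarith)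
      ultimately show "norm (f n z + f' n z - (g z + g' z)) < \<epsilon>" by (simp only:)
    qed
  qed
qed

lemma loc_uniform_limit_bounded_mult:
  assumes "loc_uniform_limit F f (\<lambda>z. 0)" "\<And>n. norm (b n) \<le> B"
  shows "loc_uniform_limit F (\<lambda>n z. b n * f n z) (\<lambda>z. 0)"
  unfolding loc_uniform_limit_def
proof (intro allI impI)
  fix R \<epsilon> :: real assume \<epsilon>: "\<epsilon> > 0"
  have B: "\<bar>B\<bar> + 1 > 0" by linarith
  then have "\<epsilon> / (\<bar>B\<bar> + 1) > 0" using \<epsilon> by simp
  from loc_uniform_limitD[OF assms(1) this, of R]
  show "\<forall>\<^sub>F n in F. \<forall>z. norm z \<le> R \<longrightarrow> norm (b n * f n z - 0) < \<epsilon>"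
  proof eventually_elim
    case (elim n)
    show ?case
    proof (intro allI impI)
      fix z :: complex assume "norm z \<le> R"
      then have "norm (f n z) < \<epsilon> / (\<bar>B\<bar> + 1)" using elim by simp
      moreover have "norm (b n) \<le> \<bar>B\<bar> + 1" using assms(2)[of n] by linarith
      ultimately have "norm (b n) * norm (f n z) \<le> (\<bar>B\<bar> + 1) * norm (f n z)"
        "(\<bar>B\<bar> + 1) * norm (f n z) < \<epsilon>"
        using B by (simp_all add: mult_right_mono less_divide_eq mult.commute)
      then show "norm (b n * f n z - 0) < \<epsilon>" by (simp add: norm_mult)
    qed
  qed
qed

lemma loc_uniform_limit_cmult:
  assumes "loc_uniform_limit F f g"
  shows "loc_uniform_limit F (\<lambda>n z. c * f n z) (\<lambda>z. c * g z)"
proof -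
  have "loc_uniform_limit F (\<lambda>n z. f n z - g z) (\<lambda>z. 0)" using assms by (simp add: loc_uniform_limit_def)
  then have "loc_uniform_limit F (\<lambda>n z. c * (f n z - g z)) (\<lambda>z. 0)"
    by (rule loc_uniform_limit_bounded_mult[where B="norm c"]) simp
  then show ?thesis by (simp add: loc_uniform_limit_def right_diff_distrib)
qed

lemma loc_uniform_limit_const: "loc_uniform_limit F (\<lambda>n. g) g"
  by (simp add: loc_uniform_limit_def)

lemma loc_uniform_limit_sum_zero:
  assumes "\<And>i. i \<in> I \<Longrightarrow> loc_uniform_limit F (f i) (\<lambda>z. 0)"
  shows "loc_uniform_limit F (\<lambda>n z. \<Sum>i\<in>I. f i n z) (\<lambda>z. 0)"
  using assms
proof (induction I rule: infinite_finite_induct)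
  case (insert x I)
  then show ?case using loc_uniform_limit_add[of F "f x" "\<lambda>z. 0" "\<lambda>n z. \<Sum>i\<in>I. f i n z" "\<lambda>z. 0"] by simp
qed (simp_all add: loc_uniform_limit_const)

definition right_invertible :: "nat filter \<Rightarrow> (nat \<Rightarrow> complex poly) \<Rightarrow> (complex \<Rightarrow> complex) set" where
  "right_invertible F P = {y \<in> entire. \<exists>u. (\<forall>n. u n \<in> entire) \<and> loc_uniform_limit F u (\<lambda>z. 0) \<and>
     loc_uniform_limit F (\<lambda>n. diff_op (P n) (u n)) y}"

lemma right_invertibleI:
  assumes "y \<in> entire" "\<And>n. u n \<in> entire" "loc_uniform_limit F u (\<lambda>z. 0)"
    "loc_uniform_limit F (\<lambda>n. diff_op (P n) (u n)) y"
  shows "y \<in> right_invertible F P"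
  unfolding right_invertible_def using assms(1) by (simp, intro exI[of _ u] conjI allI assms)

lemma subspace_right_invertible: "cfun.subspace (right_invertible F P)"
proof (rule cfun.subspaceI)
  show "0 \<in> right_invertible F P"
    by (rule right_invertibleI[where u="\<lambda>n z. 0"])
      (simp_all add: diff_op_zero zero_fun_def entire_const loc_uniform_limit_const)
  fix f assume "f \<in> right_invertible F P"
  then obtain u where u: "f \<in> entire" "\<And>n. u n \<in> entire" "loc_uniform_limit F u (\<lambda>z. 0)"
    "loc_uniform_limit F (\<lambda>n. diff_op (P n) (u n)) f"
    unfolding right_invertible_def by auto
  show "cscale c f \<in> right_invertible F P" for c
    by (rule right_invertibleI[where u="\<lambda>n z. c * u n z"])
      (use loc_uniform_limit_cmult[OF u(3), of c] loc_uniform_limit_cmult[OF u(4), of c] u(1,2) in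
        \<open>simp_all add: cscale_def entire_cmult diff_op_cmult\<close>)
  fix g assume "g \<in> right_invertible F P"
  then obtain v where v: "g \<in> entire" "\<And>n. v n \<in> entire" "loc_uniform_limit F v (\<lambda>z. 0)"
    "loc_uniform_limit F (\<lambda>n. diff_op (P n) (v n)) g"
    unfolding right_invertible_def by auto
  show "f + g \<in> right_invertible F P"
    by (rule right_invertibleI[where u="\<lambda>n z. u n z + v n z"])
      (use loc_uniform_limit_add[OF u(3) v(3)] loc_uniform_limit_add[OF u(4) v(4)] u(1,2) v(1,2) in
        \<open>simp_all add: plus_fun_def entire_add diff_op_add\<close>)
qed

lemma small_poly_preimage:
  assumes F: "F \<noteq> bot" and val: "\<forall>\<^sub>F n in F. D \<le> valence (P n)"
    and dense: "\<And>g R \<epsilon>. g \<in> entire \<Longrightarrow> \<epsilon> > 0 \<Longrightarrow>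
       \<exists>y\<in>right_invertible F P. \<forall>z. norm z \<le> R \<longrightarrow> norm (y z - g z) < \<epsilon>"
    and \<delta>: "\<delta> > 0"
  shows "\<exists>n u. D \<le> valence (P n) \<and> (\<forall>z. norm z \<le> R \<longrightarrow>
      norm (poly u z) \<le> \<delta> \<and> norm (diff_op (P n) (poly u) z - poly q z) \<le> \<delta>)"
proof -
  have \<delta>3: "\<delta> / 3 > 0" using \<delta> by simp
  obtain y where y: "y \<in> right_invertible F P" "\<forall>z. norm z \<le> R \<longrightarrow> norm (y z - poly q z) < \<delta> / 3"
    using dense[OF poly_entire \<delta>3] by blast
  obtain v where v: "\<And>n. v n \<in> entire" "loc_uniform_limit F v (\<lambda>z. 0)"
    "loc_uniform_limit F (\<lambda>n. diff_op (P n) (v n)) y"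
    using y(1) unfolding right_invertible_def by auto
  have "\<forall>\<^sub>F n in F. D \<le> valence (P n) \<and> (\<forall>z. norm z \<le> R \<longrightarrow> norm (v n z - 0) < \<delta> / 3) \<and>
     (\<forall>z. norm z \<le> R \<longrightarrow> norm (diff_op (P n) (v n) z - y z) < \<delta> / 3)"
    by (intro eventually_conj val loc_uniform_limitD[OF v(2) \<delta>3] loc_uniform_limitD[OF v(3) \<delta>3])
  then obtain n where n: "D \<le> valence (P n)" "\<And>z. norm z \<le> R \<Longrightarrow> norm (v n z - 0) < \<delta> / 3"
     "\<And>z. norm z \<le> R \<Longrightarrow> norm (diff_op (P n) (v n) z - y z) < \<delta> / 3"
    using eventually_happens'[OF F] by blast
  obtain C where C: "C > 0"
    "\<And>f R B z. f \<in> entire \<Longrightarrow> (\<And>z. norm z \<le> R + 1 \<Longrightarrow> norm (f z) \<le> B) \<Longrightarrow> norm z \<le> R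
       \<Longrightarrow> norm (diff_op (P n) f z) \<le> C * B"
    by (rule diff_op_bound[of "P n"]) blast
  define \<eta> where "\<eta> = min (\<delta> / 3) (\<delta> / 3 / C)"
  have \<eta>: "\<eta> > 0" "\<eta> \<le> \<delta> / 3" "C * \<eta> \<le> \<delta> / 3"
    using \<delta> C(1) by (auto simp: \<eta>_def min_def field_simps)
  obtain u where u: "\<And>z. norm z \<le> R + 1 \<Longrightarrow> norm (poly u z - v n z) < \<eta>"
    using entire_poly_approx[OF v(1) \<eta>(1)] by blast
  show ?thesis
  proof (intro exI conjI allI impI)
    show "D \<le> valence (P n)" by (rule n(1))
    fix z :: complex assume z: "norm z \<le> R"
    have "norm (poly u z) \<le> norm (poly u z - v n z) + norm (v n z)"
      using norm_triangle_sub[of "poly u z" "v n z"] by simp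
    moreover have "norm (poly u z - v n z) < \<eta>" by (rule u) (use z in simp)
    ultimately show "norm (poly u z) \<le> \<delta>" using n(2)[OF z] \<eta>(2) \<delta> unfolding diff_0_right by linarith
    have "norm (diff_op (P n) (\<lambda>z. poly u z - v n z) z) \<le> C * \<eta>"
      by (rule C(2)[OF entire_diff[OF poly_entire v(1)] less_imp_le[OF u] z])
    then have 1: "norm (diff_op (P n) (poly u) z - diff_op (P n) (v n) z) \<le> \<delta> / 3"
      using \<eta>(3) by (simp add: diff_op_diff poly_entire v(1))
    have "diff_op (P n) (poly u) z - poly q z = (diff_op (P n) (poly u) z - diff_op (P n) (v n) z)
        + ((diff_op (P n) (v n) z - y z) + (y z - poly q z))" by simp
    moreover have "norm \<dots> \<le> \<delta>"
      by (intro order_trans[OF norm_triangle_ineq] order_trans[OF add_left_mono[OF norm_triangle_ineq]])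
        (use 1 n(3)[OF z] y(2)[rule_format, OF z] in linarith)
    ultimately show "norm (diff_op (P n) (poly u) z - poly q z) \<le> \<delta>" by (simp only:)
  qed
qed

lemma diff_op_exp: "diff_op p (\<lambda>z. exp (a * z)) = (\<lambda>z. poly p a * exp (a * z))"
  unfolding diff_op_def higher_deriv_exp_linear poly_altdef by (simp add: sum_distrib_right mult.assoc)

lemma exp_right_invertible:
  assumes "filterlim (\<lambda>n. norm (poly (P n) a)) at_top F"
  shows "(\<lambda>z. exp (a * z)) \<in> right_invertible F P"
proof (rule right_invertibleI[where u="\<lambda>n z. inverse (poly (P n) a) * exp (a * z)"])
  show "loc_uniform_limit F (\<lambda>n z. inverse (poly (P n) a) * exp (a * z)) (\<lambda>z. 0)"
    unfolding loc_uniform_limit_def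
  proof (intro allI impI)
    fix R \<epsilon> :: real assume \<epsilon>: "\<epsilon> > 0"
    have "\<forall>\<^sub>F n in F. exp (norm a * \<bar>R\<bar>) / \<epsilon> < norm (poly (P n) a)"
      using assms unfolding filterlim_at_top_dense by blast
    then show "\<forall>\<^sub>F n in F. \<forall>z. norm z \<le> R \<longrightarrow> norm (inverse (poly (P n) a) * exp (a * z) - 0) < \<epsilon>"
    proof eventually_elim
      case (elim n)
      then have pos: "norm (poly (P n) a) > 0"
        using \<epsilon> by (meson exp_gt_zero divide_pos_pos less_trans)
      show ?case
      proof (intro allI impI)
        fix z :: complex assume "norm z \<le> R"
        then have "norm (a * z) \<le> norm a * \<bar>R\<bar>" by (simp add: norm_mult mult_left_mono)
        then have "norm (exp (a * z)) \<le> exp (norm a * \<bar>R\<bar>)"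
          using norm_exp[of "a * z"] by (meson exp_le_cancel_iff order_trans)
        also have "\<dots> < \<epsilon> * norm (poly (P n) a)" using elim \<epsilon> by (simp add: divide_less_eq mult.commute)
        finally show "norm (inverse (poly (P n) a) * exp (a * z) - 0) < \<epsilon>"
          using pos unfolding norm_mult norm_inverse diff_0_right
          by (simp only: inverse_eq_divide) (simp add: divide_less_eq)
      qed
    qed
  qed
  show "loc_uniform_limit F (\<lambda>n. diff_op (P n) (\<lambda>z. inverse (poly (P n) a) * exp (a * z))) (\<lambda>z. exp (a * z))"
    unfolding loc_uniform_limit_def
  proof (intro allI impI)
    fix R \<epsilon> :: real assume \<epsilon>: "\<epsilon> > 0"
    have "\<forall>\<^sub>F n in F. 0 < norm (poly (P n) a)"
      using assms unfolding filterlim_at_top_dense by blast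
    then show "\<forall>\<^sub>F n in F. \<forall>z. norm z \<le> R \<longrightarrow>
        norm (diff_op (P n) (\<lambda>z. inverse (poly (P n) a) * exp (a * z)) z - exp (a * z)) < \<epsilon>"
      by eventually_elim (use \<epsilon> in \<open>simp add: diff_op_cmult diff_op_exp entire_exp flip: mult.assoc\<close>)
  qed
qed (intro entire_cmult entire_exp)+

definition normalized_monom :: "nat \<Rightarrow> complex poly" where
  "normalized_monom k = monom (1 / fact k) k"

lemma higher_pderiv_normalized_monom:
  "(pderiv ^^ i) (normalized_monom k) = (if i \<le> k then normalized_monom (k - i) else 0)"
proof (induction i)
  case (Suc i)
  show ?case
  proof (cases "i < k")
    case True
    then have "fact (k - i) = of_nat (k - i) * (fact (k - Suc i) :: complex)"
      by (metis Suc_diff_Suc fact_Suc of_nat_fact of_nat_mult)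
    then show ?thesis using True Suc by (simp add: normalized_monom_def pderiv_monom)
  next
    case False
    then show ?thesis using Suc by (cases "i = k") (auto simp: normalized_monom_def pderiv_monom)
  qed
qed simp

lemma diff_op_normalized_monom:
  "diff_op p (poly (normalized_monom (j + valence p)))
     = (\<lambda>z. \<Sum>k\<le>j. coeff p (valence p + j - k) * poly (normalized_monom k) z)"
proof
  fix z
  let ?m = "valence p" and ?t = "\<lambda>i. coeff p i * poly ((pderiv ^^ i) (normalized_monom (j + valence p))) z"
  have "diff_op p (poly (normalized_monom (j + ?m))) z = (\<Sum>i\<le>degree p. ?t i)"
    by (simp add: diff_op_def higher_deriv_poly)
  also have "\<dots> = (\<Sum>i\<le>degree p + (j + ?m). ?t i)"
    by (rule sum.mono_neutral_left) (auto simp: coeff_eq_0)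
  also have "\<dots> = (\<Sum>i\<in>{?m..?m + j}. ?t i)"
    by (rule sum.mono_neutral_right) (auto simp: coeff_less_valence higher_pderiv_normalized_monom)
  also have "\<dots> = (\<Sum>k\<le>j. coeff p (?m + j - k) * poly (normalized_monom k) z)"
    by (rule sum.reindex_bij_witness[of _ "\<lambda>k. ?m + j - k" "\<lambda>i. ?m + j - i"])
      (auto simp: higher_pderiv_normalized_monom add.commute)
  finally show "diff_op p (poly (normalized_monom (j + ?m))) z
     = (\<Sum>k\<le>j. coeff p (?m + j - k) * poly (normalized_monom k) z)" .
qed

lemma self_power_le_exp_fact: "real n ^ n \<le> exp 1 ^ n * fact n"
proof -
  have "(\<Sum>k\<in>{n}. real n ^ k / fact k) \<le> (\<Sum>k. real n ^ k / fact k)"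
    using summable_exp[of "real n"] by (intro sum_le_suminf) (auto simp: divide_inverse mult.commute)
  also have "\<dots> = exp (real n)" by (simp add: exp_def divide_inverse mult.commute)
  also have "\<dots> = exp 1 ^ n" by (simp flip: exp_of_nat_mult)
  finally show ?thesis by (simp add: divide_le_eq)
qed

lemma loc_uniform_limit_scaled_normalized_monom:
  assumes nz: "\<And>n. P n \<noteq> 0"
    and val: "\<forall>\<^sub>F n in F. valence (P n) \<ge> 1"
    and lim: "filterlim (\<lambda>n. real (valence (P n)) *
            norm (coeff (P n) (valence (P n))) powr (real k / real (valence (P n)))) at_top F"
  shows "loc_uniform_limit F (\<lambda>n z. inverse (coeff (P n) (valence (P n))) ^ k *
            poly (normalized_monom (j + valence (P n))) z) (\<lambda>z. 0)"
  unfolding loc_uniform_limit_def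
proof (intro allI impI)
  fix R \<epsilon> :: real assume \<epsilon>: "\<epsilon> > 0"
  define r where "r = \<bar>R\<bar> + 1"
  have r: "r > 0" "r \<ge> R" by (auto simp: r_def)
  define \<delta> where "\<delta> = min 1 (\<epsilon> / (2 * r ^ j))"
  have \<delta>: "\<delta> > 0" "\<delta> \<le> 1" "r ^ j * \<delta> < \<epsilon>"
  proof -
    show "\<delta> > 0" "\<delta> \<le> 1" using \<epsilon> r by (auto simp: \<delta>_def)
    have "r ^ j * \<delta> \<le> r ^ j * (\<epsilon> / (2 * r ^ j))" using r by (intro mult_left_mono) (auto simp: \<delta>_def)
    also have "\<dots> < \<epsilon>" using r \<epsilon> by simp
    finally show "r ^ j * \<delta> < \<epsilon>" .
  qed
  define \<theta> where "\<theta> n = real (valence (P n)) *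
            norm (coeff (P n) (valence (P n))) powr (real k / real (valence (P n)))" for n
  have "\<forall>\<^sub>F n in F. exp 1 * r / \<delta> \<le> \<theta> n"
    using lim unfolding filterlim_at_top \<theta>_def by blast
  with val show "\<forall>\<^sub>F n in F. \<forall>z. norm z \<le> R \<longrightarrow> norm (inverse (coeff (P n) (valence (P n))) ^ k *
            poly (normalized_monom (j + valence (P n))) z - 0) < \<epsilon>"
  proof eventually_elim
    case (elim n)
    define v where "v = valence (P n)"
    define c where "c = norm (coeff (P n) v)"
    have v: "v \<ge> 1" using elim(1) by (simp add: v_def)
    have c: "c > 0" using coeff_valence[OF nz] by (simp add: c_def v_def)
    have \<theta>_eq: "\<theta> n = real v * c powr (real k / real v)" by (simp add: \<theta>_def v_def c_def)
    then have \<theta>_pos: "\<theta> n > 0" using v c by simp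
    have ck: "real v ^ v * c ^ k = \<theta> n ^ v"
    proof -
      have "(c powr (real k / real v)) ^ v = c powr (real k / real v * real v)"
        using c by (simp add: powr_power mult.commute)
      also have "\<dots> = c ^ k" using v c by (simp add: powr_realpow)
      finally show ?thesis by (simp add: \<theta>_eq power_mult_distrib)
    qed
    have ratio: "exp 1 * r / \<theta> n \<le> \<delta>" using elim(2) \<theta>_pos \<delta>(1) by (simp add: field_simps)
    have "r ^ v / (c ^ k * fact v) \<le> \<delta>"
    proof -
      have "r ^ v / (c ^ k * fact v) = r ^ v * real v ^ v / (\<theta> n ^ v * fact v)"
        using v c by (simp add: ck[symmetric] field_simps)
      also have "\<dots> \<le> r ^ v * (exp 1 ^ v * fact v) / (\<theta> n ^ v * fact v)"
        using r \<theta>_pos by (intro divide_right_mono mult_left_mono self_power_le_exp_fact) auto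
      also have "\<dots> = (exp 1 * r / \<theta> n) ^ v" by (simp add: power_mult_distrib power_divide)
      also have "\<dots> \<le> \<delta> ^ v" using ratio r \<theta>_pos by (intro power_mono) auto
      also have "\<dots> \<le> \<delta> ^ 1" using \<delta> v by (intro power_decreasing) auto
      finally show ?thesis by simp
    qed
    then have bound: "r ^ j * (r ^ v / (c ^ k * fact v)) < \<epsilon>"
      using mult_left_mono[of "r ^ v / (c ^ k * fact v)" \<delta> "r ^ j"] r \<delta>(3) by simp
    show ?case
    proof (intro allI impI)
      fix z :: complex assume "norm z \<le> R"
      then have z: "norm z ^ (j + v) \<le> r ^ (j + v)" using r by (intro power_mono) auto
      have "norm (inverse (coeff (P n) v) ^ k * poly (normalized_monom (j + v)) z)
          = norm z ^ (j + v) / (c ^ k * fact (j + v))"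
        by (simp add: normalized_monom_def poly_monom norm_mult norm_power norm_inverse norm_divide c_def field_simps)
      also have "\<dots> \<le> r ^ (j + v) / (c ^ k * fact v)"
        using z c r by (intro frac_le mult_left_mono fact_mono) auto
      also have "\<dots> < \<epsilon>" using bound by (simp add: power_add)
      finally show "norm (inverse (coeff (P n) (valence (P n))) ^ k *
            poly (normalized_monom (j + valence (P n))) z - 0) < \<epsilon>"
        by (simp add: v_def)
    qed
  qed
qed

text \<open>The factor \<open>inverse c ^ k\<close> makes the induction on \<open>j\<close> go through: inverting the lowest
  coefficient \<open>c\<close> of \<open>P n\<close> costs one power of it.\<close>

lemma exact_preimage_normalized_monom:
  assumes nz: "\<And>n. P n \<noteq> 0"
    and val: "\<forall>\<^sub>F n in F. valence (P n) \<ge> 1"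
    and lim: "\<And>k. k \<ge> 1 \<Longrightarrow> filterlim (\<lambda>n. real (valence (P n)) *
            norm (coeff (P n) (valence (P n))) powr (real k / real (valence (P n)))) at_top F"
    and bnd: "\<And>k. k \<ge> 1 \<Longrightarrow> bounded (range (\<lambda>n. coeff (P n) (k + valence (P n))))"
  shows "\<exists>u. (\<forall>n. diff_op (P n) (poly (u n)) = poly (normalized_monom j)) \<and>
     (\<forall>k. loc_uniform_limit F (\<lambda>n z. inverse (coeff (P n) (valence (P n))) ^ k * poly (u n) z) (\<lambda>z. 0))"
proof (induction j rule: less_induct)
  case (less j)
  let ?a = "\<lambda>n. inverse (coeff (P n) (valence (P n)))"
  obtain U where U: "\<And>i n. i < j \<Longrightarrow> diff_op (P n) (poly (U i n)) = poly (normalized_monom i)"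
    "\<And>i k. i < j \<Longrightarrow> loc_uniform_limit F (\<lambda>n z. ?a n ^ k * poly (U i n) z) (\<lambda>z. 0)"
  proof -
    have "\<forall>i. \<exists>u. i < j \<longrightarrow> (\<forall>n. diff_op (P n) (poly (u n)) = poly (normalized_monom i)) \<and>
       (\<forall>k. loc_uniform_limit F (\<lambda>n z. ?a n ^ k * poly (u n) z) (\<lambda>z. 0))"
      using less.IH by blast
    then obtain U where "\<forall>i. i < j \<longrightarrow> (\<forall>n. diff_op (P n) (poly (U i n)) = poly (normalized_monom i)) \<and>
       (\<forall>k. loc_uniform_limit F (\<lambda>n z. ?a n ^ k * poly (U i n) z) (\<lambda>z. 0))"
      by (rule choice[THEN exE])
    then show thesis by (intro that[of U]) simp_all
  qed
  let ?c = "\<lambda>i n. coeff (P n) (valence (P n) + j - i)"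
  define u where "u n = smult (?a n) (normalized_monom (j + valence (P n)) - (\<Sum>i<j. smult (?c i n) (U i n)))" for n
  have u_eq: "poly (u n) = (\<lambda>z. ?a n * (poly (normalized_monom (j + valence (P n))) z
      - (\<Sum>i<j. ?c i n * poly (U i n) z)))" for n
    by (simp add: u_def poly_sum fun_eq_iff)
  show ?case
  proof (intro exI[of _ u] conjI allI)
    fix n
    have "diff_op (P n) (poly (u n)) = (\<lambda>z. ?a n * ((\<Sum>i\<le>j. ?c i n * poly (normalized_monom i) z)
        - (\<Sum>i<j. ?c i n * poly (normalized_monom i) z)))"
      unfolding u_eq
      by (subst diff_op_cmult, intro entire_diff entire_sum entire_cmult poly_entire,
          subst diff_op_diff, intro poly_entire, intro entire_sum entire_cmult poly_entire,
          subst diff_op_sum, intro entire_cmult poly_entire)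
        (simp add: diff_op_cmult[OF poly_entire] U(1) diff_op_normalized_monom)
    also have "\<dots> = poly (normalized_monom j)"
      using coeff_valence[OF nz[of n]] by (simp add: fun_eq_iff lessThan_Suc_atMost[symmetric] flip: mult.assoc)
    finally show "diff_op (P n) (poly (u n)) = poly (normalized_monom j)" .
  next
    fix k
    have "loc_uniform_limit F (\<lambda>n z. - ?c i n * (?a n ^ Suc k * poly (U i n) z)) (\<lambda>z. 0)" if i: "i \<in> {..<j}" for i
    proof -
      have eq: "valence (P n) + j - i = (j - i) + valence (P n)" for n using i by simp
      have "bounded (range (\<lambda>n. ?c i n))" unfolding eq by (rule bnd) (use i in simp)
      then obtain B where "\<And>n. norm (?c i n) \<le> B" unfolding bounded_iff by auto
      then show ?thesis
        by (intro loc_uniform_limit_bounded_mult[where B=B and b="\<lambda>n. - ?c i n", OF U(2)]) (use i in simp_all)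
    qed
    then have "loc_uniform_limit F (\<lambda>n z. \<Sum>i<j. - ?c i n * (?a n ^ Suc k * poly (U i n) z)) (\<lambda>z. 0)"
      by (rule loc_uniform_limit_sum_zero)
    moreover have "loc_uniform_limit F (\<lambda>n z. ?a n ^ Suc k * poly (normalized_monom (j + valence (P n))) z) (\<lambda>z. 0)"
      by (rule loc_uniform_limit_scaled_normalized_monom[OF nz val lim]) simp
    ultimately have "loc_uniform_limit F (\<lambda>n z. ?a n ^ Suc k * poly (normalized_monom (j + valence (P n))) z
        + (\<Sum>i<j. - ?c i n * (?a n ^ Suc k * poly (U i n) z))) (\<lambda>z. 0 + 0)"
      by (rule loc_uniform_limit_add[rotated])
    moreover have "?a n ^ Suc k * poly (normalized_monom (j + valence (P n))) z
        + (\<Sum>i<j. - ?c i n * (?a n ^ Suc k * poly (U i n) z)) = ?a n ^ k * poly (u n) z" for n z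
      unfolding u_eq by (simp add: sum_negf sum_distrib_left algebra_simps)
    ultimately show "loc_uniform_limit F (\<lambda>n z. ?a n ^ k * poly (u n) z) (\<lambda>z. 0)" by (simp only: add_0)
  qed
qed

lemma poly_right_invertible:
  assumes nz: "\<And>n. P n \<noteq> 0"
    and val: "\<forall>\<^sub>F n in F. valence (P n) \<ge> 1"
    and lim: "\<And>k. k \<ge> 1 \<Longrightarrow> filterlim (\<lambda>n. real (valence (P n)) *
            norm (coeff (P n) (valence (P n))) powr (real k / real (valence (P n)))) at_top F"
    and bnd: "\<And>k. k \<ge> 1 \<Longrightarrow> bounded (range (\<lambda>n. coeff (P n) (k + valence (P n))))"
  shows "poly p \<in> right_invertible F P"
proof -
  have mon: "poly (normalized_monom j) \<in> right_invertible F P" for j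
  proof -
    obtain u where u: "\<And>n. diff_op (P n) (poly (u n)) = poly (normalized_monom j)"
      "\<And>k. loc_uniform_limit F (\<lambda>n z. inverse (coeff (P n) (valence (P n))) ^ k * poly (u n) z) (\<lambda>z. 0)"
      using exact_preimage_normalized_monom[OF nz val lim bnd, of j] by blast
    show ?thesis
      by (rule right_invertibleI[where u="\<lambda>n. poly (u n)"])
        (use u(1) u(2)[of 0] in \<open>simp_all add: poly_entire loc_uniform_limit_const\<close>)
  qed
  have "poly p = (\<Sum>j\<le>degree p. cscale (coeff p j * fact j) (poly (normalized_monom j)))"
  proof
    fix z
    have "(\<Sum>j\<in>I. cscale (coeff p j * fact j) (poly (normalized_monom j))) z
      = (\<Sum>j\<in>I. coeff p j * z ^ j)" for I
      by (induction I rule: infinite_finite_induct)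
        (simp_all add: cscale_def normalized_monom_def poly_monom)
    then show "poly p z = (\<Sum>j\<le>degree p. cscale (coeff p j * fact j) (poly (normalized_monom j))) z"
      by (simp add: poly_altdef)
  qed
  then show ?thesis
    by (simp only:) (intro cfun.subspace_sum subspace_right_invertible cfun.subspace_scale mon)
qed

lemma sphere_exp_unicity_set:
  assumes "r > 0"
  shows "exp_unicity_set (sphere 0 r)"
  unfolding exp_unicity_set_def
proof (intro ballI impI allI)
  fix f :: "complex \<Rightarrow> complex" and w
  assume f: "f \<in> exponential_type" and 0: "\<forall>z\<in>sphere 0 r. f z = 0"
  have "connected (sphere (0::complex) r)" by (rule connected_sphere) simp
  moreover have "of_real r \<in> sphere (0::complex) r" "- of_real r \<in> sphere (0::complex) r" using assms by auto
  moreover have "of_real r \<noteq> - (of_real r :: complex)" using assms by (simp add: eq_neg_iff_add_eq_0)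
  ultimately have "(of_real r :: complex) islimpt sphere 0 r"
    by (intro connected_imp_perfect) (auto simp only: singleton_iff)
  then show "f w = 0"
    using analytic_continuation[of f UNIV "sphere 0 r" "of_real r" w] f 0
    by (simp add: exponential_type_def entire_def connected_UNIV)
qed

lemma cond_R_imp_cond_P: "cond_R P \<Longrightarrow> cond_P P"
proof -
  assume "cond_R P"
  then obtain r where r: "r > 0"
    and lim: "filterlim (\<lambda>n. INF z\<in>sphere 0 r. norm (poly (P n) z)) at_top sequentially"
    unfolding cond_R_def by blast
  have "filterlim (\<lambda>n. norm (poly (P n) z)) at_top sequentially" if "z \<in> sphere 0 r" for z
  proof (rule filterlim_at_top_mono[OF lim], intro always_eventually allI)
    show "(INF z\<in>sphere 0 r. norm (poly (P n) z)) \<le> norm (poly (P n) z)" for n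
      by (rule cINF_lower[OF _ that]) (rule bdd_belowI2[of _ 0], simp)
  qed
  then show "cond_P P"
    unfolding cond_P_def using sphere_exp_unicity_set[OF r] by blast
qed

text \<open>Limits along \<open>valence_filter P\<close> are limits along those \<open>n\<close> with \<open>n \<rightarrow> \<infinity>\<close> and
  \<open>valence (P n) \<rightarrow> \<infinity>\<close>; this replaces passing to a subsequence.\<close>

definition valence_filter :: "(nat \<Rightarrow> complex poly) \<Rightarrow> nat filter" where
  "valence_filter P = inf sequentially (filtercomap (\<lambda>n. valence (P n)) at_top)"

lemma valence_filter_neq_bot:
  assumes "\<not> bdd_above (range (\<lambda>n. valence (P n)))"
  shows "valence_filter P \<noteq> bot"
proof
  assume "valence_filter P = bot"
  then have "eventually (\<lambda>n. False) (valence_filter P)" by simp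
  then obtain Q Q' where Q: "eventually Q sequentially"
    "eventually Q' (filtercomap (\<lambda>n. valence (P n)) at_top)" "\<And>n. Q n \<Longrightarrow> \<not> Q' n"
    unfolding valence_filter_def eventually_inf by blast
  obtain K where K: "\<And>n. n \<ge> K \<Longrightarrow> Q n" using Q(1) unfolding eventually_sequentially by blast
  obtain D where D: "\<And>n. valence (P n) \<ge> D \<Longrightarrow> Q' n"
    using Q(2) unfolding eventually_filtercomap_at_top_linorder by blast
  have "valence (P n) \<le> D + (\<Sum>i<K. valence (P i))" for n
  proof (cases "n < K")
    case True
    then have "valence (P n) \<le> (\<Sum>i<K. valence (P i))" by (intro member_le_sum) auto
    then show ?thesis by simp
  next
    case False
    then show ?thesis using K[of n] D[of n] Q(3)[of n] by (cases "valence (P n) \<ge> D") auto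
  qed
  then show False using assms by (auto simp: bdd_above_def)
qed

lemma eventually_le_valence: "\<forall>\<^sub>F n in valence_filter P. D \<le> valence (P n)"
  unfolding valence_filter_def
  by (rule filter_leD[OF inf_le2]) (auto simp: eventually_filtercomap_at_top_linorder)

lemma valence_filter_le: "valence_filter P \<le> sequentially"
  unfolding valence_filter_def by simp

theorem theorem3p2:
  fixes P :: "nat \<Rightarrow> complex poly"
  assumes nonconstant: "\<And>n. degree (P n) > 0"
    and unbounded_valences: "\<not> bdd_above (range (\<lambda>n. valence (P n)))"
    and PQR: "cond_P P \<or> cond_Q P \<or> cond_R P"
  shows "maximal_dense_lineable cscale entire_topology
           (HC entire_topology entire_topology (\<lambda>n. diff_op (P n)))"
proof -
  let ?F = "valence_filter P"
  have nz: "P n \<noteq> 0" for n using nonconstant[of n] by auto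
  have along: "filterlim f at_top ?F" if "filterlim f at_top sequentially" for f :: "nat \<Rightarrow> real"
    using that valence_filter_le by (rule filterlim_mono[OF _ order_refl])
  have dense: "\<exists>y\<in>right_invertible ?F P. \<forall>z. norm z \<le> R \<longrightarrow> norm (y z - g z) < \<epsilon>"
    if g: "g \<in> entire" and \<epsilon>: "\<epsilon> > 0" for g and R \<epsilon> :: real
  proof (cases "cond_Q P")
    case True
    have val: "\<forall>\<^sub>F n in ?F. valence (P n) \<ge> 1" by (rule eventually_le_valence)
    obtain p where p: "\<And>z. norm z \<le> R \<Longrightarrow> norm (poly p z - g z) < \<epsilon>"
      using entire_poly_approx[OF g \<epsilon>] by blast
    have "poly p \<in> right_invertible ?F P"
      by (rule poly_right_invertible[OF nz val]) (use True along in \<open>simp_all add: cond_Q_def\<close>)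
    then show ?thesis using p by (intro bexI[of _ "poly p"]) simp_all
  next
    case False
    then have "cond_P P" using PQR cond_R_imp_cond_P by blast
    then obtain U where U: "exp_unicity_set U"
      "\<And>a. a \<in> U \<Longrightarrow> filterlim (\<lambda>n. norm (poly (P n) a)) at_top sequentially"
      unfolding cond_P_def by blast
    have "cfun.span ((\<lambda>a z. exp (a * z)) ` U) \<subseteq> right_invertible ?F P"
      by (intro cfun.span_minimal subspace_right_invertible image_subsetI exp_right_invertible along U(2))
    then show ?thesis using dense_span_exp[OF U(1) g \<epsilon>, of R] by (meson subsetD)
  qed
  show ?thesis
    by (rule maximal_dense_lineable_HC_diff_op)
      (rule small_poly_preimage[OF valence_filter_neq_bot[OF unbounded_valences] eventually_le_valence dense])
qed

end
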